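(* Let $0<a\leq1$, let $N\geq 1$ be an integer, $m\in\{1,\ldots,N\}$, $k\in\{1,\ldots,m\}$. Let $U$ be the unique solution of the $2\times 2$ Riemann–Hilbert problem in the context. Then $$U_{11}(0)=\kappa_N^{m,k}(a),$$ where $\kappa_N^{m,k}(a)$ is the leading coefficient of $p_N^{m,k}(z;a)$, with $p_N^{m,k}(z;a)/q_N^{m,k}(z;a)$ the type $[m-k,k-1]$ Padé approximant near $z=-a$ of the function $f_N^{m,k}(z;a)=z^{m-k}(1-az)^{N-m+1}$.
   Context: Riemann–Hilbert problem for $U$. Let $\Sigma_1$ be a simple positively oriented closed contour around $a$ but not enclosing $-1/a$, and $\Sigma_2$ a simple positively oriented closed contour encircling $\Sigma_1$ and $0$. (a) $U:\mathbb C\setminus(\Sigma_1\cup\Sigma_2)\to\mathbb C^{2\times2}$ is analytic. (b) $U$ admits continuous boundary values $U_\pm(z)$ as $z\in\Sigma_1\cup\Sigma_2$ is approached from the left ($+$) or right ($-$) of the oriented contour, and $U_+(z)=U_-(z)J_U(z)$, with $$J_U(z)=\begin{pmatrix}1&\frac{z^{N-m+k}}{(z-a)^{N-m+1}(1+az)^m}\\0&1\end{pmatrix},\ z\in\Sigma_1,\qquad J_U(z)=\begin{pmatrix}1&0\\-\frac{(z-a)^{N-m+1}(1+az)^m}{z^{N-m+k}}&1\end{pmatrix},\ z\in\Sigma_2.$$ (c) $U(z)=I_2+O(z^{-1})$ as $z\to\infty$. This problem has a unique solution. (The first column of $U$ has no jump across $\Sigma_1$, so $U_{11}(0)$ is unambiguous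 even if $0\in\Sigma_1$.) Padé approximant: $p_N^{m,k}(z;a)$ is a polynomial in $z$ of degree at most $m-k$ and $q_N^{m,k}(z;a)$ is a polynomial in $z$ of degree at most $k-1$, normalized by $q_N^{m,k}(0;a)=1$, such that $$p_N^{m,k}(z;a)-f_N^{m,k}(z;a)q_N^{m,k}(z;a)=O((z+a)^m),\qquad z\to-a.$$ Such a pair exists and is unique. The leading coefficient $\kappa_N^{m,k}(a)$ is the coefficient of $z^{m-k}$ in $p_N^{m,k}(z;a)$. *)

theory Defs
  imports "HOL-Complex_Analysis.Complex_Analysis" "HOL-Library.Landau_Symbols"
begin

text \<open>
  Contours are piecewise continuously differentiable. Along a positively oriented simple closed
  contour the left (plus) side is its interior and the right (minus) side its exterior.
\<close>

definition pos_closed_contour :: "(real \<Rightarrow> complex) \<Rightarrow> bool" where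
  "pos_closed_contour \<gamma> \<longleftrightarrow>
     valid_path \<gamma> \<and> simple_path \<gamma> \<and> pathfinish \<gamma> = pathstart \<gamma> \<and>
     (\<forall>z\<in>inside (path_image \<gamma>). winding_number \<gamma> z = 1)"

definition has_jump ::
    "(complex \<Rightarrow> complex^2^2) \<Rightarrow> (real \<Rightarrow> complex) \<Rightarrow> (complex \<Rightarrow> complex^2^2) \<Rightarrow> bool" where
  "has_jump U \<gamma> J \<longleftrightarrow>
     (\<exists>U_plus U_minus.
        continuous_on (path_image \<gamma>) U_plus \<and> continuous_on (path_image \<gamma>) U_minus \<and>
        (\<forall>\<zeta>\<in>path_image \<gamma>.
           (U \<longlongrightarrow> U_plus \<zeta>) (at \<zeta> within inside (path_image \<gamma>)) \<and>
           (U \<longlongrightarrow> U_minus \<zeta>) (at \<zeta> within outside (path_image \<gamma>)) \<and>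
           U_plus \<zeta> = U_minus \<zeta> ** J \<zeta>))"

definition jump_1 :: "nat \<Rightarrow> nat \<Rightarrow> nat \<Rightarrow> real \<Rightarrow> complex \<Rightarrow> complex^2^2" where
  "jump_1 N m k a z =
     vector [vector [1, z^(N - m + k) / ((z - of_real a)^(N - m + 1) * (1 + of_real a * z)^m)],
             vector [0, 1]]"

definition jump_2 :: "nat \<Rightarrow> nat \<Rightarrow> nat \<Rightarrow> real \<Rightarrow> complex \<Rightarrow> complex^2^2" where
  "jump_2 N m k a z =
     vector [vector [1, 0],
             vector [- ((z - of_real a)^(N - m + 1) * (1 + of_real a * z)^m / z^(N - m + k)), 1]]"

text \<open>
  The values of \<open>U\<close> on the contours themselves are irrelevant: one-sided limits are taken within
  the interior and the exterior, and analyticity is only required off the contours.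
\<close>

definition RHP_solution ::
    "nat \<Rightarrow> nat \<Rightarrow> nat \<Rightarrow> real \<Rightarrow> (real \<Rightarrow> complex) \<Rightarrow> (real \<Rightarrow> complex) \<Rightarrow>
     (complex \<Rightarrow> complex^2^2) \<Rightarrow> bool" where
  "RHP_solution N m k a \<gamma>1 \<gamma>2 U \<longleftrightarrow>
     (\<forall>i j. (\<lambda>z. U z $ i $ j) analytic_on - (path_image \<gamma>1 \<union> path_image \<gamma>2)) \<and>
     has_jump U \<gamma>1 (jump_1 N m k a) \<and>
     has_jump U \<gamma>2 (jump_2 N m k a) \<and>
     (\<forall>i j. (\<lambda>z. U z $ i $ j - (mat 1 :: complex^2^2) $ i $ j) \<in> O[at_infinity](\<lambda>z. 1 / z))"

definition pade_f :: "nat \<Rightarrow> nat \<Rightarrow> nat \<Rightarrow> real \<Rightarrow> complex \<Rightarrow> complex" where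
  "pade_f N m k a z = z^(m - k) * (1 - of_real a * z)^(N - m + 1)"

definition is_pade ::
    "nat \<Rightarrow> nat \<Rightarrow> nat \<Rightarrow> real \<Rightarrow> complex poly \<Rightarrow> complex poly \<Rightarrow> bool" where
  "is_pade N m k a p q \<longleftrightarrow>
     degree p \<le> m - k \<and> degree q \<le> k - 1 \<and> poly q 0 = 1 \<and>
     (\<lambda>z. poly p z - pade_f N m k a z * poly q z)
        \<in> O[at (- of_real a)](\<lambda>z. (z + of_real a)^m)"

text \<open>
  The pair \<open>(p, q)\<close> is unique for \<open>a > 0\<close> and \<open>1 \<le> k \<le> m \<le> N\<close>. The leading coefficient is the
  coefficient of \<open>z\<close> to the power \<open>m - k\<close>, the maximal admissible degree of \<open>p\<close>.
\<close>

definition pade_pair :: "nat \<Rightarrow> nat \<Rightarrow> nat \<Rightarrow> real \<Rightarrow> complex poly \<times> complex poly" where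
  "pade_pair N m k a = (THE (p, q). is_pade N m k a p q)"

definition pade_kappa :: "nat \<Rightarrow> nat \<Rightarrow> nat \<Rightarrow> real \<Rightarrow> complex" where
  "pade_kappa N m k a = coeff (fst (pade_pair N m k a)) (m - k)"

end

theory Submission
  imports Defs
begin

text \<open>
  Write \<open>(u, v)\<close> for the first row of \<open>U\<close> and put \<open>r = N - m + 1\<close>, \<open>M = N - m + k\<close>. Across the
  inner contour \<open>u\<close> has no jump and \<open>v\<close> jumps by \<open>u\<close> times \<open>z ^ M / ((z - a) ^ r * (1 + a z) ^ m)\<close>;
  across the outer contour \<open>v\<close> has no jump and \<open>u\<close> jumps by \<open>v\<close> times the reciprocal of that weight.
  Three functions therefore have no jump left:
  \<^item> inside the outer contour, \<open>u\<close> continues to an analytic function \<open>A\<close>;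
  \<^item> \<open>(z - a) ^ r * v\<close>, corrected by \<open>z ^ M / (1 + a z) ^ m * A\<close> inside the inner contour, is entire
    and of growth \<open>z ^ (r - 1)\<close>, hence a polynomial \<open>Q\<close>;
  \<^item> \<open>z ^ M * u\<close> outside the outer contour continues to \<open>z ^ M * A + Q * (1 + a z) ^ m\<close> inside it, which
    is entire and equals \<open>z ^ M\<close> up to \<open>O(z ^ (M - 1))\<close>, hence a monic polynomial \<open>R\<close>.

  Since \<open>v\<close> is analytic at \<open>a\<close>, the polynomial \<open>R\<close> is divisible by \<open>(z - a) ^ r\<close>, say
  \<open>R = (z - a) ^ r * S\<close>, and \<open>A\<close> is a polynomial with
  \<open>z ^ M * A = (z - a) ^ r * S - Q * (1 + a z) ^ m\<close>. Replacing \<open>z\<close> by \<open>1 / z\<close> and multiplying by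
  \<open>z ^ N\<close> turns this identity into the Pade condition, with \<open>p\<close> and \<open>q\<close> the reversals of \<open>A\<close> and
  \<open>S\<close>. The leading coefficient of \<open>p\<close> is then \<open>A(0) = u(0)\<close>. These steps are collected in
  \<open>first_row_polynomials\<close> and \<open>pade_kappa_eq\<close>.

  Two facts carry the argument. The first is that a function which is continuous on an open set and
  analytic off a simple closed contour is analytic on the whole set
  (\<open>holomorphic_across_simple_path\<close>); it is what allows boundary values that agree to be glued, and it
  rests on covering a curve of finite length by few small squares. The second is the uniqueness of the
  Pade approximant (\<open>is_pade_unique\<close>), without which the leading coefficient would not be determined
  by the pair just found; it is proved by counting real zeros with Rolle's theorem.
\<close>

section \<open>Integrals along the sides of a rectangle\<close>

definition horizontal_integral :: "(complex \<Rightarrow> complex) \<Rightarrow> real \<Rightarrow> real \<Rightarrow> real \<Rightarrow> complex" where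
  "horizontal_integral f y a b = contour_integral (linepath (Complex a y) (Complex b y)) f"

definition vertical_integral :: "(complex \<Rightarrow> complex) \<Rightarrow> real \<Rightarrow> real \<Rightarrow> real \<Rightarrow> complex" where
  "vertical_integral f x a b = contour_integral (linepath (Complex x a) (Complex x b)) f"

text \<open>
  An oriented integral: no order of \<open>x, x'\<close> or of \<open>y, y'\<close> is presupposed, because the primitive in
  Morera's theorem compares points in every relative position.
\<close>
definition rectangle_integral ::
    "(complex \<Rightarrow> complex) \<Rightarrow> real \<Rightarrow> real \<Rightarrow> real \<Rightarrow> real \<Rightarrow> complex" where
  "rectangle_integral f x x' y y' =
     horizontal_integral f y x x' + vertical_integral f x' y y'
     - horizontal_integral f y' x x' - vertical_integral f x y y'"

lemma closed_segment_horizontal: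
  "closed_segment (Complex a y) (Complex b y) = {z. Im z = y \<and> Re z \<in> closed_segment a b}"
  by (auto simp: closed_segment_same_Im)

lemma closed_segment_vertical:
  "closed_segment (Complex x a) (Complex x b) = {z. Re z = x \<and> Im z \<in> closed_segment a b}"
  by (auto simp: closed_segment_same_Re)

text \<open>
  Additivity along a line holds whichever of the three points lies between the other two, as for an
  oriented real integral.
\<close>
lemma contour_integral_linepath_collinear:
  assumes f: "continuous_on S f" "convex S" "a \<in> S" "b \<in> S" "c \<in> S"
    and col: "b \<in> closed_segment a c \<or> a \<in> closed_segment b c \<or> c \<in> closed_segment a b"
  shows "contour_integral (linepath a b) f + contour_integral (linepath b c) f
       = contour_integral (linepath a c) f"
proof -
  have co: "continuous_on (closed_segment u v) f" if "u \<in> S" "v \<in> S" for u v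
    using that f by (meson closed_segment_subset continuous_on_subset)
  note rev = contour_integral_reverse_linepath[OF co]
  note sp = contour_integral_split_linepath[OF co]
  from col show ?thesis
  proof (elim disjE)
    assume "b \<in> closed_segment a c" then show ?thesis using sp[of a c b] f by simp
  next
    assume "a \<in> closed_segment b c" then show ?thesis
      using sp[of b c a] rev[of a b] f by simp
  next
    assume "c \<in> closed_segment a b" then show ?thesis
      using sp[of a b c] rev[of b c] f by simp
  qed
qed

lemma horizontal_integral_combine:
  assumes "continuous_on S f" "convex S" "Complex a y \<in> S" "Complex b y \<in> S" "Complex c y \<in> S"
  shows "horizontal_integral f y a b + horizontal_integral f y b c = horizontal_integral f y a c"
  unfolding horizontal_integral_def
  by (rule contour_integral_linepath_collinear[OF assms])
     (auto simp: closed_segment_horizontal closed_segment_eq_real_ivl)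

lemma vertical_integral_combine:
  assumes "continuous_on S f" "convex S" "Complex x a \<in> S" "Complex x b \<in> S" "Complex x c \<in> S"
  shows "vertical_integral f x a b + vertical_integral f x b c = vertical_integral f x a c"
  unfolding vertical_integral_def
  by (rule contour_integral_linepath_collinear[OF assms])
     (auto simp: closed_segment_vertical closed_segment_eq_real_ivl)

lemma horizontal_integral_self [simp]: "horizontal_integral f y a a = 0"
  by (simp add: horizontal_integral_def)

lemma vertical_integral_self [simp]: "vertical_integral f x a a = 0"
  by (simp add: vertical_integral_def)

text \<open>
  If \<open>f\<close> stays within \<open>e\<close> of a constant \<open>w\<close> on a side, the integral differs from that of the constant
  by at most \<open>e\<close> times the length. It is used both to differentiate a primitive and to bound the
  integral around a small cell by the oscillation of \<open>f\<close>.
\<close>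
lemma horizontal_integral_deviation:
  assumes "continuous_on (closed_segment (Complex a y) (Complex b y)) f" "e \<ge> 0"
    and "\<And>z. z \<in> closed_segment (Complex a y) (Complex b y) \<Longrightarrow> norm (f z - w) \<le> e"
  shows "norm (horizontal_integral f y a b - w * of_real (b - a)) \<le> e * \<bar>b - a\<bar>"
proof -
  have eq: "Complex b y - Complex a y = of_real (b - a)" by (simp add: complex_eq_iff)
  have "((\<lambda>z. f z - w) has_contour_integral horizontal_integral f y a b - w * (Complex b y - Complex a y))
        (linepath (Complex a y) (Complex b y))"
    unfolding horizontal_integral_def
    by (intro has_contour_integral_diff has_contour_integral_integral has_contour_integral_const_linepath
        contour_integrable_continuous_linepath assms)
  from has_contour_integral_bound_linepath[OF this assms(2,3)]
  show ?thesis by (simp only: eq norm_of_real)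
qed

lemma vertical_integral_deviation:
  assumes "continuous_on (closed_segment (Complex x a) (Complex x b)) f" "e \<ge> 0"
    and "\<And>z. z \<in> closed_segment (Complex x a) (Complex x b) \<Longrightarrow> norm (f z - w) \<le> e"
  shows "norm (vertical_integral f x a b - w * (\<i> * of_real (b - a))) \<le> e * \<bar>b - a\<bar>"
proof -
  have eq: "Complex x b - Complex x a = \<i> * of_real (b - a)" by (simp add: complex_eq_iff)
  have "((\<lambda>z. f z - w) has_contour_integral vertical_integral f x a b - w * (Complex x b - Complex x a))
        (linepath (Complex x a) (Complex x b))"
    unfolding vertical_integral_def
    by (intro has_contour_integral_diff has_contour_integral_integral has_contour_integral_const_linepath
        contour_integrable_continuous_linepath assms)
  from has_contour_integral_bound_linepath[OF this assms(2,3)]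
  show ?thesis by (simp only: eq norm_mult norm_ii norm_of_real mult_1)
qed

lemma rectangle_integral_swap:
  assumes "continuous_on S f" "convex S" 
    "Complex x y \<in> S" "Complex x' y \<in> S" "Complex x y' \<in> S" "Complex x' y' \<in> S"
  shows "rectangle_integral f x' x y y' = - rectangle_integral f x x' y y'"
    and "rectangle_integral f x x' y' y = - rectangle_integral f x x' y y'"
proof -
  have "horizontal_integral f t x' x = - horizontal_integral f t x x'" if "t = y \<or> t = y'" for t
    using horizontal_integral_combine[OF assms(1,2), of x t x' x] assms that
    by (auto simp: eq_neg_iff_add_eq_0 add.commute)
  moreover have "vertical_integral f t y' y = - vertical_integral f t y y'" if "t = x \<or> t = x'" for t
    using vertical_integral_combine[OF assms(1,2), of t y y' y] assms that
    by (auto simp: eq_neg_iff_add_eq_0 add.commute)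
  ultimately show "rectangle_integral f x' x y y' = - rectangle_integral f x x' y y'"
      "rectangle_integral f x x' y' y = - rectangle_integral f x x' y y'"
    by (simp_all add: rectangle_integral_def)
qed

text \<open>
  Morera's theorem for axis-parallel rectangles. A primitive is obtained by integrating from a base
  point first horizontally and then vertically; the vanishing of rectangle integrals says that the
  other order gives the same result, so that increments of the primitive are integrals over short
  paths near the given point.
\<close>
lemma Morera_rectangle_box:
  fixes f :: "complex \<Rightarrow> complex"
  assumes cont: "continuous_on (box p q) f"
    and zero: "\<And>x x' y y'. x \<le> x' \<Longrightarrow> y \<le> y' \<Longrightarrow> cbox (Complex x y) (Complex x' y') \<subseteq> box p q
                 \<Longrightarrow> rectangle_integral f x x' y y' = 0"
  shows "f holomorphic_on box p q"
proof (cases "box p q = {}")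
  case False
  then obtain c where c: "c \<in> box p q" by blast
  have zero': "rectangle_integral f x x' y y' = 0" 
    if in_box: "Complex x y \<in> box p q" "Complex x' y' \<in> box p q" for x x' y y'
  proof -
    have le: "rectangle_integral f x x' y y' = 0"
      if "x \<le> x'" "y \<le> y'" "Complex x y \<in> box p q" "Complex x' y' \<in> box p q" for x x' y y'
      using that by (intro zero) (auto simp: in_box_complex_iff in_cbox_complex_iff)
    have sw: "rectangle_integral f x' x y y' = - rectangle_integral f x x' y y'"
      "rectangle_integral f x x' y' y = - rectangle_integral f x x' y y'"
      if "Complex x y \<in> box p q" "Complex x' y' \<in> box p q" for x x' y y'
      using that by (auto intro!: rectangle_integral_swap[OF cont] simp: in_box_complex_iff)
    show ?thesis
    proof (cases "x \<le> x'"; cases "y \<le> y'")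
      assume "x \<le> x'" "y \<le> y'" then show ?thesis using le in_box by blast
    next
      assume "x \<le> x'" "\<not> y \<le> y'" then show ?thesis
        using le[of x x' y' y] sw(2)[of x y x' y'] in_box by (auto simp: in_box_complex_iff)
    next
      assume "\<not> x \<le> x'" "y \<le> y'" then show ?thesis
        using le[of x' x y y'] sw(1)[of x y x' y'] in_box by (auto simp: in_box_complex_iff)
    next
      assume "\<not> x \<le> x'" "\<not> y \<le> y'" then show ?thesis
        using le[of x' x y' y] sw(1)[of x y x' y'] sw(2)[of x' y x y'] in_box
        by (auto simp: in_box_complex_iff)
    qed
  qed
  define F where
    "F z = horizontal_integral f (Im c) (Re c) (Re z) + vertical_integral f (Re z) (Im c) (Im z)" for z
  have diffF: "F w - F z = horizontal_integral f (Im z) (Re z) (Re w) + vertical_integral f (Re w) (Im z) (Im w)"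
    if zw: "z \<in> box p q" "w \<in> box p q" for z w
  proof -
    have "rectangle_integral f (Re z) (Re w) (Im c) (Im z) = 0"
      using zw c by (intro zero') (auto simp: in_box_complex_iff)
    moreover have "horizontal_integral f (Im c) (Re c) (Re z) + horizontal_integral f (Im c) (Re z) (Re w)
        = horizontal_integral f (Im c) (Re c) (Re w)"
      using zw c by (intro horizontal_integral_combine[OF cont]) (auto simp: in_box_complex_iff)
    moreover have "vertical_integral f (Re w) (Im c) (Im z) + vertical_integral f (Re w) (Im z) (Im w)
        = vertical_integral f (Re w) (Im c) (Im w)"
      using zw c by (intro vertical_integral_combine[OF cont]) (auto simp: in_box_complex_iff)
    ultimately show ?thesis 
      unfolding F_def rectangle_integral_def by algebra
  qed
  have "(F has_field_derivative f z) (at z)" if z: "z \<in> box p q" for z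
    unfolding has_field_derivative_def has_derivative_at_alt
  proof (intro conjI allI impI)
    show "bounded_linear ((*) (f z))" by (rule bounded_linear_mult_right)
    fix e :: real assume e: "e > 0"
    have "isCont f z" using cont z continuous_on_eq_continuous_at open_box by blast
    then obtain d1 where d1: "d1 > 0" "\<And>w. dist w z < d1 \<Longrightarrow> dist (f w) (f z) < e/2"
      unfolding continuous_at_eps_delta using e by (metis half_gt_zero)
    obtain d2 where d2: "d2 > 0" "ball z d2 \<subseteq> box p q"
      using z open_box openE by blast
    \<comment> \<open>The increment to \<open>w\<close> runs along two segments each at most as long as \<open>w - z\<close>, whence \<open>e / 2\<close>.\<close>
    show "\<exists>d>0. \<forall>w. norm (w - z) < d \<longrightarrow> norm (F w - F z - f z * (w - z)) \<le> e * norm (w - z)"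
    proof (intro exI[of _ "min d1 d2"] conjI allI impI)
      show "0 < min d1 d2" using d1 d2 by simp
      fix w assume w: "norm (w - z) < min d1 d2"
      then have wB: "w \<in> box p q" using d2 by (auto simp: dist_norm norm_minus_commute)
      have near: "norm (v - z) \<le> norm (w - z)"
        if "Re v \<in> closed_segment (Re z) (Re w)" "Im v \<in> closed_segment (Im z) (Im w)" for v
      proof -
        have "\<bar>Re v - Re z\<bar> \<le> \<bar>Re w - Re z\<bar>" "\<bar>Im v - Im z\<bar> \<le> \<bar>Im w - Im z\<bar>"
          using that by (auto simp: closed_segment_eq_real_ivl split: if_splits)
        then show ?thesis
          by (simp add: cmod_def abs_le_square_iff add_mono)
      qed
      have fz: "norm (f v - f z) \<le> e/2" "v \<in> box p q"
        if "Re v \<in> closed_segment (Re z) (Re w)" "Im v \<in> closed_segment (Im z) (Im w)" for v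
      proof -
        show "norm (f v - f z) \<le> e/2" 
          using near[OF that] w d1(2)[of v] by (simp add: dist_norm)
        show "v \<in> box p q" using near[OF that] w d2(2)
          by (intro subsetD[OF d2(2)]) (simp add: dist_norm norm_minus_commute)
      qed
      have h: "norm (horizontal_integral f (Im z) (Re z) (Re w) - f z * of_real (Re w - Re z)) \<le> e/2 * \<bar>Re w - Re z\<bar>"
        by (rule horizontal_integral_deviation)
           (use fz e in \<open>auto simp: closed_segment_horizontal simp del: complex.collapse intro!: continuous_on_subset[OF cont]\<close>)
      have v: "norm (vertical_integral f (Re w) (Im z) (Im w) - f z * (\<i> * of_real (Im w - Im z))) \<le> e/2 * \<bar>Im w - Im z\<bar>"
        by (rule vertical_integral_deviation)
           (use fz e in \<open>auto simp: closed_segment_vertical simp del: complex.collapse intro!: continuous_on_subset[OF cont]\<close>)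
      have wz: "w - z = of_real (Re w - Re z) + \<i> * of_real (Im w - Im z)"
        by (simp add: complex_eq_iff)
      have "norm (F w - F z - f z * (w - z)) \<le> e/2 * \<bar>Re w - Re z\<bar> + e/2 * \<bar>Im w - Im z\<bar>"
        unfolding diffF[OF z wB] 
        by (rule order_trans[OF _ order_trans[OF norm_triangle_ineq add_mono[OF h v]]])
           (subst wz, simp add: algebra_simps)
      also have "\<dots> \<le> e/2 * norm (w - z) + e/2 * norm (w - z)"
        using abs_Re_le_cmod[of "w - z"] abs_Im_le_cmod[of "w - z"] e
        by (intro add_mono mult_left_mono) auto
      finally show "norm (F w - F z - f z * (w - z)) \<le> e * norm (w - z)" by (simp add: field_simps)
    qed
  qed
  then have F': "(F has_field_derivative f z) (at z)" if "z \<in> box p q" for z using that by blast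
  then have "F holomorphic_on box p q" 
    using open_box holomorphic_on_open by blast
  then have "deriv F holomorphic_on box p q" by (intro holomorphic_deriv open_box)
  then show ?thesis using F' by (auto elim!: holomorphic_transform intro: DERIV_imp_deriv)
qed (simp add: holomorphic_on_def)

lemma rectangle_integral_holomorphic:
  assumes "f holomorphic_on cbox (Complex x y) (Complex x' y')" "x \<le> x'" "y \<le> y'"
  shows "rectangle_integral f x x' y y' = 0"
proof -
  let ?B = "cbox (Complex x y) (Complex x' y')"
  have cont: "continuous_on ?B f" using assms(1) holomorphic_on_imp_continuous_on by blast
  have co: "continuous_on (closed_segment u v) f" if "u \<in> ?B" "v \<in> ?B" for u v
    using that cont by (meson closed_segment_subset continuous_on_subset convex_box(1))
  have ci: "f contour_integrable_on linepath u v" if "u \<in> ?B" "v \<in> ?B" for u v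
    using co that contour_integrable_continuous_linepath by blast
  have "(f has_contour_integral 0) (rectpath (Complex x y) (Complex x' y'))"
    using assms path_image_rectpath_subset_cbox[of "Complex x y" "Complex x' y'"]
    by (intro Cauchy_theorem_convex_simple[OF assms(1)]) auto
  then have "contour_integral (rectpath (Complex x y) (Complex x' y')) f = 0"
    by (rule contour_integral_unique)
  then have "contour_integral (linepath (Complex x y) (Complex x' y)) f
     + (contour_integral (linepath (Complex x' y) (Complex x' y')) f
     + (contour_integral (linepath (Complex x' y') (Complex x y')) f
     + contour_integral (linepath (Complex x y') (Complex x y)) f)) = 0"
    using assms(2,3)
    by (simp add: rectpath_def Let_def contour_integral_join ci in_cbox_complex_iff)
  moreover have
    "contour_integral (linepath (Complex x' y') (Complex x y')) f = - horizontal_integral f y' x x'"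
    "contour_integral (linepath (Complex x y') (Complex x y)) f = - vertical_integral f x y y'"
    unfolding horizontal_integral_def vertical_integral_def
    using assms(2,3) by (auto intro!: contour_integral_reverse_linepath co simp: in_cbox_complex_iff)
  ultimately show ?thesis
    unfolding rectangle_integral_def
    by (simp only: horizontal_integral_def vertical_integral_def) algebra
qed

text \<open>
  The constant \<open>w\<close> integrates to zero around the rectangle, so only the deviation of \<open>f\<close> from it counts.
\<close>
lemma rectangle_integral_oscillation:
  assumes "continuous_on (cbox (Complex x y) (Complex x' y')) f" "x \<le> x'" "y \<le> y'" "e \<ge> 0"
    and "\<And>z. z \<in> cbox (Complex x y) (Complex x' y') \<Longrightarrow> norm (f z - w) \<le> e"
  shows "norm (rectangle_integral f x x' y y') \<le> 2 * e * ((x' - x) + (y' - y))"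
proof -
  note co = continuous_on_subset[OF assms(1)]
  have sub: "closed_segment (Complex x t) (Complex x' t) \<subseteq> cbox (Complex x y) (Complex x' y')" 
    if "y \<le> t" "t \<le> y'" for t
    using that assms by (auto simp: closed_segment_horizontal in_cbox_complex_iff closed_segment_eq_real_ivl)
  have sub2: "closed_segment (Complex t y) (Complex t y') \<subseteq> cbox (Complex x y) (Complex x' y')" 
    if "x \<le> t" "t \<le> x'" for t
    using that assms by (auto simp: closed_segment_vertical in_cbox_complex_iff closed_segment_eq_real_ivl)
  have h: "norm (horizontal_integral f t x x' - w * of_real (x' - x)) \<le> e * \<bar>x' - x\<bar>" if "y \<le> t" "t \<le> y'" for t
    using sub[OF that] assms by (intro horizontal_integral_deviation co) auto
  have v: "norm (vertical_integral f t y y' - w * (\<i> * of_real (y' - y))) \<le> e * \<bar>y' - y\<bar>" if "x \<le> t" "t \<le> x'" for t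
    using sub2[OF that] assms by (intro vertical_integral_deviation co) auto
  define W1 W2 where "W1 = w * of_real (x' - x)" and "W2 = w * (\<i> * of_real (y' - y))"
  have "rectangle_integral f x x' y y' = (horizontal_integral f y x x' - W1) + (vertical_integral f x' y y' - W2)
     - (horizontal_integral f y' x x' - W1) - (vertical_integral f x y y' - W2)"
    by (simp add: rectangle_integral_def)
  also have "norm \<dots> \<le> e * \<bar>x' - x\<bar> + e * \<bar>y' - y\<bar> + e * \<bar>x' - x\<bar> + e * \<bar>y' - y\<bar>"
    unfolding W1_def W2_def
    by (intro order_trans[OF norm_triangle_ineq4] order_trans[OF norm_triangle_ineq] add_mono h v) (use assms in auto)
  also have "\<dots> = 2 * e * ((x' - x) + (y' - y))" using assms by (simp add: algebra_simps)
  finally show ?thesis .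
qed

text \<open>
  Every interior side of the grid is traversed twice in opposite directions, so that the double sum
  telescopes to the outer boundary.
\<close>
lemma rectangle_integral_grid:
  fixes n :: nat and x y s t :: real
  assumes cont: "continuous_on (cbox (Complex x y) (Complex (x + n * s) (y + n * t))) f" "s \<ge> 0" "t \<ge> 0"
  shows "rectangle_integral f x (x + n * s) y (y + n * t) =
    (\<Sum>i<n. \<Sum>j<n. rectangle_integral f (x + i * s) (x + Suc i * s) (y + j * t) (y + Suc j * t))"
proof -
  define S where "S = cbox (Complex x y) (Complex (x + n * s) (y + n * t))"
  have inS: "Complex (x + real i * s) (y + real j * t) \<in> S" if "i \<le> n" "j \<le> n" for i j
    using that assms(2,3) by (auto simp: S_def in_cbox_complex_iff intro!: mult_right_mono)
  have co: "continuous_on S f" "convex S" using cont by (auto simp: S_def convex_box)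
  have h: "horizontal_integral f (y + real j * t) x (x + real m * s) =
     (\<Sum>i<m. horizontal_integral f (y + real j * t) (x + real i * s) (x + real (Suc i) * s))"
    if "m \<le> n" "j \<le> n" for j m
    using that
  proof (induction m)
    case (Suc m)
    then show ?case 
      using horizontal_integral_combine[OF co, of x "y + real j * t" "x + real m * s" "x + real (Suc m) * s"]
        inS[of 0 j] inS[of m j] inS[of "Suc m" j] by simp
  qed simp
  have v: "vertical_integral f (x + real i * s) y (y + real m * t) =
     (\<Sum>j<m. vertical_integral f (x + real i * s) (y + real j * t) (y + real (Suc j) * t))"
    if "m \<le> n" "i \<le> n" for i m
    using that
  proof (induction m)
    case (Suc m)
    then show ?case 
      using vertical_integral_combine[OF co, of "x + real i * s" y "y + real m * t" "y + real (Suc m) * t"]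
        inS[of i 0] inS[of i m] inS[of i "Suc m"] by simp
  qed simp
  define h' where "h' i j = horizontal_integral f (y + real j * t) (x + real i * s) (x + real (Suc i) * s)" for i j
  define v' where "v' i j = vertical_integral f (x + real i * s) (y + real j * t) (y + real (Suc j) * t)" for i j
  have "(\<Sum>i<n. \<Sum>j<n. rectangle_integral f (x + i * s) (x + Suc i * s) (y + j * t) (y + Suc j * t))
     = (\<Sum>i<n. \<Sum>j<n. (h' i j - h' i (Suc j)) + (v' (Suc i) j - v' i j))"
    by (simp add: rectangle_integral_def h'_def v'_def algebra_simps)
  also have "\<dots> = (\<Sum>i<n. \<Sum>j<n. h' i j - h' i (Suc j)) + (\<Sum>j<n. \<Sum>i<n. v' (Suc i) j - v' i j)"
    by (simp add: sum.distrib sum.swap[of "\<lambda>i j. v' (Suc i) j - v' i j"])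
  also have "\<dots> = (\<Sum>i<n. h' i 0 - h' i n) + (\<Sum>j<n. v' n j - v' 0 j)"
    by (simp add: sum_lessThan_telescope' sum_lessThan_telescope[where f = "\<lambda>i. v' i j" for j])
  also have "\<dots> = rectangle_integral f x (x + n * s) y (y + n * t)"
    using h[of n 0] h[of n n] v[of n 0] v[of n n]
    by (simp add: rectangle_integral_def h'_def v'_def sum_subtractf)
  finally show ?thesis by simp
qed

section \<open>Continuous functions that are analytic off a curve\<close>

text \<open>
  A curve of finite length meets only \<open>O(n)\<close> of the \<open>n\<^sup>2\<close> cells of an \<open>n\<close> by \<open>n\<close> grid: cut it into \<open>n\<close>
  arcs of diameter at most \<open>L (d - c) / n\<close>; each arc is comparable in size to a cell and therefore
  meets a number of cells bounded independently of \<open>n\<close>.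
\<close>
lemma card_grid_cells_meeting_curve:
  fixes \<gamma> :: "real \<Rightarrow> complex" and n :: nat and x y :: real
  assumes lip: "L-lipschitz_on {c..d} \<gamma>" and "c \<le> d" "n > 0" "w > 0" "h > 0"
  defines "cell \<equiv> \<lambda>i j. cbox (Complex (x + real i * (w / n)) (y + real j * (h / n)))
                             (Complex (x + real (Suc i) * (w / n)) (y + real (Suc j) * (h / n)))"
  shows "card {(i, j). i < n \<and> j < n \<and> cell i j \<inter> \<gamma> ` {c..d} \<noteq> {}} \<le>
    n * ((2 * nat \<lceil>L * (d - c) / w + 1\<rceil> + 1) * (2 * nat \<lceil>L * (d - c) / h + 1\<rceil> + 1))"
proof -
  define A where "A = nat \<lceil>L * (d - c) / w + 1\<rceil>"
  define B where "B = nat \<lceil>L * (d - c) / h + 1\<rceil>"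
  define t where "t k = c + real k * ((d - c) / n)" for k
  define hit where "hit k = {(i, j). i < n \<and> j < n \<and> cell i j \<inter> \<gamma> ` ({t k..t (Suc k)} \<inter> {c..d}) \<noteq> {}}" for k
  have parts: "\<exists>k<n. s \<in> {t k..t (Suc k)}" if s: "s \<in> {c..d}" for s
  proof -
    have "s \<in> {t 0..t n}" using s \<open>n > 0\<close> by (simp add: t_def)
    moreover have "\<exists>k<m. s \<in> {t k..t (Suc k)}" if "m > 0" "s \<in> {t 0..t m}" for m
      using that
    proof (induction m)
      case (Suc m)
      show ?case
      proof (cases "s \<in> {t m..t (Suc m)}")
        case False
        with Suc.prems have s': "s \<in> {t 0..t m}" by auto
        with False Suc.prems have "m > 0" by (cases "m = 0") auto
        with Suc.IH s' obtain k where "k < m" "s \<in> {t k..t (Suc k)}" by blast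
        then show ?thesis by (intro exI[of _ k]) auto
      qed auto
    qed simp
    ultimately show ?thesis using \<open>n > 0\<close> by blast
  qed
  have cover: "{(i, j). i < n \<and> j < n \<and> cell i j \<inter> \<gamma> ` {c..d} \<noteq> {}} \<subseteq> (\<Union>k<n. hit k)"
  proof
    fix u assume "u \<in> {(i, j). i < n \<and> j < n \<and> cell i j \<inter> \<gamma> ` {c..d} \<noteq> {}}"
    then obtain i j where u: "u = (i, j)" and ij: "i < n" "j < n" and ne: "cell i j \<inter> \<gamma> ` {c..d} \<noteq> {}"
      by blast
    from ne obtain s where s: "\<gamma> s \<in> cell i j" "s \<in> {c..d}" by blast
    from parts[OF s(2)] obtain k where k: "k < n" "s \<in> {t k..t (Suc k)}" by blast
    have "\<gamma> s \<in> cell i j \<inter> \<gamma> ` ({t k..t (Suc k)} \<inter> {c..d})" using s k(2) by blast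
    then have "(i, j) \<in> hit k" unfolding hit_def using ij by blast
    then show "u \<in> (\<Union>k<n. hit k)" using k(1) u by blast
  qed
  have fin: "finite (hit k)" for k
    by (rule finite_subset[of _ "{..<n} \<times> {..<n}"]) (auto simp: hit_def)
  have close: "dist u v \<le> L * ((d - c) / n)"
    if "u \<in> \<gamma> ` ({t k..t (Suc k)} \<inter> {c..d})" "v \<in> \<gamma> ` ({t k..t (Suc k)} \<inter> {c..d})" for u v k
  proof -
    from that obtain r s where rs: "r \<in> {t k..t (Suc k)} \<inter> {c..d}" "s \<in> {t k..t (Suc k)} \<inter> {c..d}" 
      "u = \<gamma> r" "v = \<gamma> s" by blast
    have "dist u v \<le> L * dist r s" using rs lip by (auto intro: lipschitz_onD)
    also have "dist r s \<le> t (Suc k) - t k" using rs by (auto simp: dist_real_def)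
    also have "t (Suc k) - t k = (d - c) / n" by (simp add: t_def algebra_simps add_divide_distrib diff_divide_distrib)
    finally show ?thesis using lipschitz_on_nonneg[OF lip] by (simp add: mult_left_mono)
  qed
  \<comment> \<open>Two cells met by the same arc have column numbers that differ by at most one more than the number of columns the arc can span; likewise for rows.\<close>
  have index: "i \<le> i' + nat \<lceil>L * (d - c) / l + 1\<rceil>" 
    if "l > 0" "p \<ge> z + real i * (l / n)" "q \<le> z + real (Suc i') * (l / n)" "p - q \<le> L * ((d - c) / n)"
    for l p q z :: real and i i' :: nat
  proof -
    have "real i * (l / n) - real (Suc i') * (l / n) \<le> L * ((d - c) / n)" using that by linarith
    then have "(real i - real (Suc i')) * l / n \<le> L * (d - c) / n"
      by (simp only: left_diff_distrib right_diff_distrib diff_divide_distrib times_divide_eq_right)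
    then have "(real i - real (Suc i')) * l \<le> L * (d - c)" using \<open>n > 0\<close>
      by (simp add: divide_le_cancel)
    then have "real i - real (Suc i') \<le> L * (d - c) / l" using \<open>l > 0\<close> by (simp add: field_simps)
    then show ?thesis by linarith
  qed
  have "card (hit k) \<le> (2 * A + 1) * (2 * B + 1)" for k
  proof (cases "hit k = {}")
    case False
    then obtain i0 j0 q where q: "q \<in> cell i0 j0" "q \<in> \<gamma> ` ({t k..t (Suc k)} \<inter> {c..d})"
      unfolding hit_def by blast
    have "hit k \<subseteq> {i0 - A..i0 + A} \<times> {j0 - B..j0 + B}"
    proof clarify
      fix i j assume "(i, j) \<in> hit k"
      then obtain p where p: "p \<in> cell i j" "p \<in> \<gamma> ` ({t k..t (Suc k)} \<inter> {c..d})"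
        unfolding hit_def by blast
      have "dist p q \<le> L * ((d - c) / n)" using close p q by blast
      then have "\<bar>Re p - Re q\<bar> \<le> L * ((d - c) / n)" "\<bar>Im p - Im q\<bar> \<le> L * ((d - c) / n)"
        using abs_Re_le_cmod[of "p - q"] abs_Im_le_cmod[of "p - q"] by (auto simp: dist_norm)
      then have le: "Re p - Re q \<le> L * ((d - c) / n)" "Re q - Re p \<le> L * ((d - c) / n)"
        "Im p - Im q \<le> L * ((d - c) / n)" "Im q - Im p \<le> L * ((d - c) / n)" by linarith+
      have pq: "x + real i * (w / n) \<le> Re p" "Re p \<le> x + real (Suc i) * (w / n)"
        "y + real j * (h / n) \<le> Im p" "Im p \<le> y + real (Suc j) * (h / n)"
        "x + real i0 * (w / n) \<le> Re q" "Re q \<le> x + real (Suc i0) * (w / n)"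
        "y + real j0 * (h / n) \<le> Im q" "Im q \<le> y + real (Suc j0) * (h / n)"
        using p(1) q(1) unfolding cell_def in_cbox_complex_iff complex.sel atLeastAtMost_iff by blast+
      have "i \<le> i0 + A" "i0 \<le> i + A" "j \<le> j0 + B" "j0 \<le> j + B"
        unfolding A_def B_def
        by (rule index[OF \<open>w > 0\<close> pq(1,6) le(1)] index[OF \<open>w > 0\<close> pq(5,2) le(2)]
            index[OF \<open>h > 0\<close> pq(3,8) le(3)] index[OF \<open>h > 0\<close> pq(7,4) le(4)])+
      then show "i \<in> {i0 - A..i0 + A} \<and> j \<in> {j0 - B..j0 + B}" by auto
    qed
    then have "card (hit k) \<le> card ({i0 - A..i0 + A} \<times> {j0 - B..j0 + B})"
      by (intro card_mono) auto
    also have "\<dots> \<le> (2 * A + 1) * (2 * B + 1)"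
      unfolding card_cartesian_product by (intro mult_mono) auto
    finally show ?thesis .
  qed simp
  then have "card (\<Union>k<n. hit k) \<le> n * ((2 * A + 1) * (2 * B + 1))"
    using card_UN_le[of "{..<n}" hit] sum_mono[of "{..<n}" "\<lambda>k. card (hit k)" "\<lambda>_. (2 * A + 1) * (2 * B + 1)"]
    by simp
  then show ?thesis
    using card_mono[OF _ cover] fin unfolding A_def B_def by (meson finite_UN_I finite_lessThan le_trans)
qed

text \<open>
  Divide the rectangle into \<open>n\<^sup>2\<close> cells. Cells that miss the curve contribute zero by Cauchy's theorem.
  The remaining ones number \<open>O(n)\<close>, have perimeter \<open>O(1/n)\<close>, and on each of them \<open>f\<close> oscillates by
  less than \<open>e\<close> once \<open>n\<close> is large. Their total contribution is \<open>O(e)\<close>.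
\<close>
lemma rectangle_integral_zero_off_lipschitz_curve:
  fixes f :: "complex \<Rightarrow> complex" and \<gamma> :: "real \<Rightarrow> complex"
  assumes S: "open S" and cont: "continuous_on S f" and holo: "f holomorphic_on S - \<gamma> ` {c..d}"
    and lip: "L-lipschitz_on {c..d} \<gamma>" "c \<le> d"
    and sub: "cbox (Complex x y) (Complex x' y') \<subseteq> S" and le: "x < x'" "y < y'"
  shows "rectangle_integral f x x' y y' = 0"
proof -
  define w h where "w = x' - x" and "h = y' - y"
  define C where "C = (2 * nat \<lceil>L * (d - c) / w + 1\<rceil> + 1) * (2 * nat \<lceil>L * (d - c) / h + 1\<rceil> + 1)"
  have wh: "w > 0" "h > 0" using le by (simp_all add: w_def h_def)
  let ?B = "cbox (Complex x y) (Complex x' y')"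
  have small: "norm (rectangle_integral f x x' y y') \<le> e * (2 * real C * (w + h))" if e: "e > 0" for e
  proof -
    have cB: "continuous_on ?B f" using cont sub continuous_on_subset by blast
    then have "uniformly_continuous_on ?B f" by (intro compact_uniformly_continuous) auto
    then obtain \<delta> where \<delta>: "\<delta> > 0" "\<And>u v. u \<in> ?B \<Longrightarrow> v \<in> ?B \<Longrightarrow> dist v u < \<delta> \<Longrightarrow> dist (f v) (f u) < e"
      unfolding uniformly_continuous_on_def using e by metis
    obtain n :: nat where n: "n > 0" "(w + h) / n < \<delta>"
    proof -
      obtain n :: nat where n: "real n > (w + h) / \<delta>" using reals_Archimedean2 by blast
      then have "n > 0" using wh \<delta>(1) by (metis add_pos_pos divide_pos_pos less_trans of_nat_0_less_iff)
      with n \<delta>(1) show ?thesis by (intro that[of n]) (auto simp: field_simps)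
    qed
    define cell where "cell = (\<lambda>i j. cbox (Complex (x + real i * (w / n)) (y + real j * (h / n)))
                             (Complex (x + real (Suc i) * (w / n)) (y + real (Suc j) * (h / n))))"
    define I where "I = (\<lambda>i j. rectangle_integral f (x + real i * (w / n)) (x + real (Suc i) * (w / n))
        (y + real j * (h / n)) (y + real (Suc j) * (h / n)))"
    define hit where "hit = {(i, j). i < n \<and> j < n \<and> cell i j \<inter> \<gamma> ` {c..d} \<noteq> {}}"
    have cellB: "cell i j \<subseteq> ?B" if "i < n" "j < n" for i j
    proof -
      have *: "real (Suc m) * (l / n) \<le> l" if "m < n" "l > 0" for m and l :: real
      proof -
        have "real (Suc m) * l \<le> real n * l" using that by (intro mult_right_mono) auto
        then show ?thesis using n(1) by (simp add: field_simps)
      qed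
      show ?thesis using *[OF that(1) wh(1)] *[OF that(2) wh(2)] wh
        unfolding cell_def by (intro subset_box_imp) (auto simp: w_def h_def Basis_complex_def)
    qed
    have step_le: "real i * (l / n) \<le> real (Suc i) * (l / n)" if "l > 0" for i and l :: real
      using that by (intro mult_right_mono) auto
    have len: "real (Suc i) * l - real i * l = l" for i and l :: real by (simp add: algebra_simps)
    have zero: "I i j = 0" if "i < n" "j < n" "(i, j) \<notin> hit" for i j
      unfolding I_def
    proof (rule rectangle_integral_holomorphic)
      show "f holomorphic_on cbox (Complex (x + real i * (w / n)) (y + real j * (h / n)))
                             (Complex (x + real (Suc i) * (w / n)) (y + real (Suc j) * (h / n)))"
        using that cellB[OF that(1,2)] sub
        by (intro holomorphic_on_subset[OF holo]) (auto simp: hit_def cell_def)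
    qed (use step_le wh in auto)
    have bound: "norm (I i j) \<le> 2 * e * ((w + h) / n)" if "(i, j) \<in> hit" for i j
    proof -
      have ij: "i < n" "j < n" using that by (auto simp: hit_def)
      define v where "v = Complex (x + real i * (w / n)) (y + real j * (h / n))"
      have v: "v \<in> cell i j"
        using step_le wh by (auto simp: cell_def v_def in_cbox_complex_iff simp del: of_nat_Suc)
      have "norm (I i j) \<le> 2 * e * ((x + real (Suc i) * (w / n) - (x + real i * (w / n)))
             + (y + real (Suc j) * (h / n) - (y + real j * (h / n))))"
        unfolding I_def
      proof (rule rectangle_integral_oscillation[where w = "f v"])
        show "continuous_on (cbox (Complex (x + real i * (w / n)) (y + real j * (h / n)))
                             (Complex (x + real (Suc i) * (w / n)) (y + real (Suc j) * (h / n)))) f"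
          using continuous_on_subset[OF cB cellB[OF ij]] by (simp add: cell_def)
        fix z assume "z \<in> cbox (Complex (x + real i * (w / n)) (y + real j * (h / n)))
                             (Complex (x + real (Suc i) * (w / n)) (y + real (Suc j) * (h / n)))"
        then have z: "z \<in> cell i j" by (simp add: cell_def)
        have "dist z v \<le> \<bar>Re (z - v)\<bar> + \<bar>Im (z - v)\<bar>" 
          using cmod_le[of "z - v"] by (simp add: dist_norm)
        also have "\<dots> \<le> w / n + h / n"
          using z wh by (intro add_mono) (auto simp: cell_def v_def in_cbox_complex_iff algebra_simps add_divide_distrib)
        also have "\<dots> < \<delta>" using n by (simp add: add_divide_distrib)
        finally show "norm (f z - f v) \<le> e"
          using \<delta>(2)[of v z] cellB[OF ij] z v by (force simp: dist_norm)
      qed (use step_le wh e in auto)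
      also have "\<dots> = 2 * e * ((w + h) / n)" 
        by (simp only: add_diff_cancel_left len add_divide_distrib)
      finally show ?thesis .
    qed
    have fin: "finite hit" by (rule finite_subset[of _ "{..<n} \<times> {..<n}"]) (auto simp: hit_def)
    have ends: "x + real n * (w / n) = x'" "y + real n * (h / n) = y'" using n by (auto simp: w_def h_def)
    have "rectangle_integral f x x' y y' = (\<Sum>i<n. \<Sum>j<n. I i j)"
      using rectangle_integral_grid[where x = x and y = y and n = n and s = "w / n" and t = "h / n" and f = f] cB wh n unfolding ends I_def by simp
    also have "\<dots> = (\<Sum>(i, j)\<in>{..<n} \<times> {..<n}. I i j)" by (simp add: sum.cartesian_product)
    also have "\<dots> = (\<Sum>(i, j)\<in>hit. I i j)"
      using zero by (intro sum.mono_neutral_right) (auto simp: hit_def)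
    also have "norm \<dots> \<le> (\<Sum>(i, j)\<in>hit. 2 * e * ((w + h) / n))"
      using bound by (intro sum_norm_le) auto
    also have "\<dots> = real (card hit) * (2 * e * ((w + h) / n))" by (simp add: case_prod_unfold)
    also have "\<dots> \<le> real (n * C) * (2 * e * ((w + h) / n))"
      using card_grid_cells_meeting_curve[OF lip n(1) wh, of x y] e wh
      unfolding hit_def cell_def C_def by (intro mult_right_mono of_nat_mono) auto
    also have "\<dots> = e * (2 * real C * (w + h))" using n by (simp add: field_simps)
    finally show ?thesis .
  qed
  have "norm (rectangle_integral f x x' y y') \<le> 0"
  proof (rule field_le_epsilon)
    fix e :: real assume e: "e > 0"
    define M where "M = 2 * real C * (w + h) + 1"
    have "0 \<le> 2 * real C * (w + h)" using wh by simp
    then have M: "M > 0" "2 * real C * (w + h) \<le> M" by (auto simp: M_def)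
    show "norm (rectangle_integral f x x' y y') \<le> 0 + e"
      using small[of "e / M"] e M mult_left_mono[OF M(2), of "e / M"] by simp
  qed
  then show ?thesis by simp
qed

lemma holomorphic_across_lipschitz_curve:
  fixes f :: "complex \<Rightarrow> complex" and \<gamma> :: "real \<Rightarrow> complex"
  assumes S: "open S" and cont: "continuous_on S f" and holo: "f holomorphic_on S - \<gamma> ` {c..d}"
    and lip: "L-lipschitz_on {c..d} \<gamma>" "c \<le> d"
  shows "f holomorphic_on S"
proof -
  have "\<exists>p q. z \<in> box p q \<and> f holomorphic_on box p q" if z: "z \<in> S" for z
  proof -
    obtain p q where pq: "z \<in> box p q" "box p q \<subseteq> S"
      using z S by (metis open_contains_box mem_box(1) subsetD box_subset_cbox)
    have "f holomorphic_on box p q"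
    proof (rule Morera_rectangle_box)
      show "continuous_on (box p q) f" using cont pq continuous_on_subset by blast
      fix x x' y y' :: real
      assume xy: "x \<le> x'" "y \<le> y'" "cbox (Complex x y) (Complex x' y') \<subseteq> box p q"
      show "rectangle_integral f x x' y y' = 0"
      proof (cases "x = x' \<or> y = y'")
        case False
        then show ?thesis 
          using xy pq by (intro rectangle_integral_zero_off_lipschitz_curve[OF S cont holo lip]) auto
      qed (auto simp: rectangle_integral_def)
    qed
    with pq show ?thesis by blast
  qed
  then show ?thesis
    using S by (metis holomorphic_on_imp_differentiable_at holomorphic_on_open field_differentiable_def open_box)
qed

lemma C1_differentiable_on_imp_lipschitz:
  assumes "\<gamma> C1_differentiable_on {c..d}"
  obtains L where "L-lipschitz_on {c..d} \<gamma>"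
proof -
  obtain D where D: "\<And>t. t \<in> {c..d} \<Longrightarrow> (\<gamma> has_vector_derivative D t) (at t)" "continuous_on {c..d} D"
    using assms unfolding C1_differentiable_on_def by blast
  have "bounded (D ` {c..d})" using D(2) by (intro compact_imp_bounded compact_continuous_image) auto
  then obtain B where B: "B > 0" "\<And>t. t \<in> {c..d} \<Longrightarrow> norm (D t) \<le> B" 
    unfolding bounded_pos by blast
  have "B-lipschitz_on {c..d} \<gamma>"
  proof (rule bounded_derivative_imp_lipschitz)
    show "(\<gamma> has_derivative (\<lambda>h. h *\<^sub>R D t)) (at t within {c..d})" if "t \<in> {c..d}" for t
      using D(1)[OF that] unfolding has_vector_derivative_def by (rule has_derivative_at_withinI)
    show "onorm (\<lambda>h. h *\<^sub>R D t) \<le> B" if "t \<in> {c..d}" for t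
      using B(2)[OF that] by (intro onorm_bound) (auto simp: B(1) less_imp_le mult.commute[of B] intro!: mult_left_mono)
  qed (use B in auto)
  then show ?thesis by (rule that)
qed

text \<open>
  A piecewise continuously differentiable path in the sense of \<^const>\<open>valid_path\<close> may have
  unbounded derivative, and even infinite length, near its finitely many break points. Near any other
  point of the image the path is Lipschitz, and since the path is simple no other part of it comes close; so
  the function is analytic off a finite set, where continuity makes the singularities removable.
\<close>
lemma holomorphic_across_simple_path:
  fixes f :: "complex \<Rightarrow> complex"
  assumes \<gamma>: "valid_path \<gamma>" "simple_path \<gamma>" and S: "open S" and cont: "continuous_on S f" 
    and holo: "f holomorphic_on S - path_image \<gamma>"
  shows "f holomorphic_on S"
proof -
  obtain E where E: "finite E" "\<gamma> C1_differentiable_on ({0..1} - E)"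
    using \<gamma>(1) unfolding valid_path_def piecewise_C1_differentiable_on_def by blast
  define K where "K = \<gamma> ` ((E \<union> {0, 1}) \<inter> {0..1})"
  have K: "finite K" using E by (simp add: K_def)
  have contg: "continuous_on {0..1} \<gamma>" using \<gamma>(1) valid_path_imp_path path_def by blast
  have diff: "f field_differentiable at z" if z: "z \<in> S - K" for z
  proof (cases "z \<in> path_image \<gamma>")
    case False
    have "open (S - path_image \<gamma>)" using S \<gamma>(1) by (simp add: closed_valid_path_image open_Diff)
    then show ?thesis using False z holo holomorphic_on_imp_differentiable_at by blast
  next
    case True
    then obtain t where t: "t \<in> {0..1}" "z = \<gamma> t" by (auto simp: path_image_def)
    with z have "t \<notin> E \<union> {0, 1}" by (auto simp: K_def)
    then have "t \<in> {0<..<1} - E" using t by auto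
    moreover have "open ({0<..<1} - E)" using E by (intro open_Diff finite_imp_closed) auto
    ultimately obtain e where e: "e > 0" "cball t e \<subseteq> {0<..<1} - E" 
      using open_contains_cball by blast
    define c d where "c = t - e" and "d = t + e"
    have cd: "{c..d} \<subseteq> {0<..<1} - E" "c < t" "t < d" 
      using e by (auto simp: c_def d_def cball_eq_atLeastAtMost)
    have "\<gamma> C1_differentiable_on {c..d}" using cd by (intro C1_differentiable_on_subset[OF E(2)]) auto
    then obtain L where L: "L-lipschitz_on {c..d} \<gamma>" by (rule C1_differentiable_on_imp_lipschitz)
    \<comment> \<open>Inside \<open>V\<close> only the Lipschitz arc over \<open>{c..d}\<close> is visible.\<close>
    define V where "V = S - \<gamma> ` ({0..1} - {c<..<d})"
    have "compact ({0..1} - {c<..<d})" by (intro compact_diff) auto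
    then have "compact (\<gamma> ` ({0..1} - {c<..<d}))"
      by (intro compact_continuous_image continuous_on_subset[OF contg]) auto
    then have V: "open V" unfolding V_def using S by (intro open_Diff compact_imp_closed)
    have "f holomorphic_on V"
    proof (rule holomorphic_across_lipschitz_curve[OF V _ _ L])
      show "continuous_on V f" using cont by (rule continuous_on_subset) (auto simp: V_def)
      show "f holomorphic_on V - \<gamma> ` {c..d}"
        using holo by (rule holomorphic_on_subset) (auto simp: V_def path_image_def)
    qed (use cd in auto)
    moreover have "z \<in> V"
    proof -
      have "\<gamma> t \<noteq> \<gamma> s" if "s \<in> {0..1}" "s \<notin> {c<..<d}" for s
        using \<gamma>(2) t cd that \<open>t \<in> {0<..<1} - E\<close> unfolding simple_path_def loop_free_def by force
      then have "z \<notin> \<gamma> ` ({0..1} - {c<..<d})" unfolding t(2) by blast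
      then show ?thesis using z by (simp add: V_def)
    qed
    ultimately show ?thesis using V holomorphic_on_imp_differentiable_at by blast
  qed
  have "open (S - K)" using S K by (simp add: finite_imp_closed open_Diff)
  then have "f holomorphic_on S - K"
    using diff by (simp add: holomorphic_on_def field_differentiable_at_within)
  then show ?thesis using no_isolated_singularity cont S K by blast
qed

text \<open>
  The form in which jumps are removed: boundary values from the two sides that agree and depend
  continuously on the point of the contour fill in the missing values of \<open>g\<close>.
\<close>
lemma holomorphic_glue_across_contour:
  fixes g h :: "complex \<Rightarrow> complex"
  assumes \<gamma>: "valid_path \<gamma>" "simple_path \<gamma>" and S: "open S" 
    and holo: "g holomorphic_on S - path_image \<gamma>"
    and h: "continuous_on (path_image \<gamma>) h"
    and plus: "\<And>z. z \<in> path_image \<gamma> \<Longrightarrow> (g \<longlongrightarrow> h z) (at z within inside (path_image \<gamma>))"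
    and minus: "\<And>z. z \<in> path_image \<gamma> \<Longrightarrow> (g \<longlongrightarrow> h z) (at z within outside (path_image \<gamma>))"
  shows "(\<lambda>z. if z \<in> path_image \<gamma> then h z else g z) holomorphic_on S" (is "?G holomorphic_on S")
proof (rule holomorphic_across_simple_path[OF \<gamma> S])
  have op: "open (S - path_image \<gamma>)" using S \<gamma>(1) by (simp add: closed_valid_path_image open_Diff)
  show G: "?G holomorphic_on S - path_image \<gamma>"
    using holo by (rule holomorphic_transform) auto
  show "continuous_on S ?G"
  proof (rule continuous_at_imp_continuous_on, rule ballI)
    fix z assume z: "z \<in> S"
    show "isCont ?G z"
    proof (cases "z \<in> path_image \<gamma>")
      case False
      then show ?thesis
        using G op z by (meson DiffI continuous_on_eq_continuous_at holomorphic_on_imp_continuous_on)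
    next
      case True
      let ?in = "inside (path_image \<gamma>)" and ?out = "outside (path_image \<gamma>)"
      have "\<forall>\<^sub>F w in at z within ?in. g w = ?G w" "\<forall>\<^sub>F w in at z within ?out. g w = ?G w"
           "\<forall>\<^sub>F w in at z within path_image \<gamma>. h w = ?G w"
        using inside_no_overlap[of "path_image \<gamma>"] outside_no_overlap[of "path_image \<gamma>"]
        unfolding disjoint_iff by (auto simp: eventually_at_filter intro!: always_eventually)
      moreover have "(h \<longlongrightarrow> h z) (at z within path_image \<gamma>)"
        using h True by (simp add: continuous_on_def)
      ultimately have "(?G \<longlongrightarrow> h z) (at z within ?in)" "(?G \<longlongrightarrow> h z) (at z within ?out)"
          "(?G \<longlongrightarrow> h z) (at z within path_image \<gamma>)"
        using plus[OF True] minus[OF True] by (auto elim: Lim_transform_eventually)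
      then have "(?G \<longlongrightarrow> h z) (at z within (path_image \<gamma> \<union> (?in \<union> ?out)))"
        by (intro Lim_Un)
      moreover have "path_image \<gamma> \<union> (?in \<union> ?out) = UNIV" by (auto simp: inside_Un_outside)
      ultimately show ?thesis using True by (simp add: isCont_def)
    qed
  qed
qed

section \<open>Real zeros of a polynomial and of its derivatives\<close>

definition root_count :: "real \<Rightarrow> real \<Rightarrow> real poly \<Rightarrow> nat" where
  "root_count \<alpha> \<beta> p = (\<Sum>x | x \<in> {\<alpha>..\<beta>} \<and> poly p x = 0. order x p)"

text \<open>
  Rolle's theorem with multiplicities. Each zero of \<open>p\<close> keeps its multiplicity less one in the
  derivative, and the derivative gains a zero strictly between any two consecutive zeros of \<open>p\<close>; with
  \<open>t\<close> distinct zeros the loss is \<open>t\<close> and the gain \<open>t - 1\<close>.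
\<close>
lemma root_count_le_pderiv:
  assumes "pderiv p \<noteq> 0"
  shows "root_count \<alpha> \<beta> p \<le> Suc (root_count \<alpha> \<beta> (pderiv p))"
proof -
  define R where "R = {x. x \<in> {\<alpha>..\<beta>} \<and> poly p x = 0}"
  define R' where "R' = {x. x \<in> {\<alpha>..\<beta>} \<and> poly (pderiv p) x = 0}"
  have p: "p \<noteq> 0" using assms by auto
  have fin: "finite R" "finite R'" 
    using poly_roots_finite[OF p] poly_roots_finite[OF assms] by (auto simp: R_def R'_def)
  have ord: "order x p = Suc (order x (pderiv p))" if "x \<in> R" for x
    using that p by (intro order_pderiv) (auto simp: R_def)
  show ?thesis
  proof (cases "R = {}")
    case True
    show ?thesis unfolding root_count_def R_def[symmetric] True by simp
  next
    case False
    \<comment> \<open>The zeros that have a successor \<open>nxt r\<close>; \<open>g r\<close> below is a Rolle point between the two.\<close>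
    define R0 where "R0 = R - {Max R}"
    define nxt where "nxt r = Min {x \<in> R. r < x}" for r
    have nxt: "nxt r \<in> R" "r < nxt r" "\<And>x. x \<in> R \<Longrightarrow> r < x \<Longrightarrow> nxt r \<le> x" if "r \<in> R0" for r
    proof -
      have "r < Max R" using that fin by (metis DiffD1 DiffD2 Max_ge R0_def order_neq_le_trans singletonI)
      then have ne: "{x \<in> R. r < x} \<noteq> {}" using Max_in[OF fin(1) False] by blast
      then have "nxt r \<in> {x \<in> R. r < x}" unfolding nxt_def using fin by (intro Min_in) auto
      then show "nxt r \<in> R" "r < nxt r" by auto
      show "nxt r \<le> x" if "x \<in> R" "r < x" for x
        unfolding nxt_def using fin that by (intro Min_le) auto
    qed
    have "\<exists>x. r < x \<and> x < nxt r \<and> poly (pderiv p) x = 0" if "r \<in> R0" for r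
    proof -
      have "poly p r = 0" "poly p (nxt r) = 0" using nxt(1)[OF that] that by (auto simp: R_def R0_def)
      then show ?thesis using poly_MVT[OF nxt(2)[OF that], of p] nxt(2)[OF that] by force
    qed
    then obtain g where g: "\<And>r. r \<in> R0 \<Longrightarrow> r < g r \<and> g r < nxt r \<and> poly (pderiv p) (g r) = 0"
      by metis
    have mono: "g r < g s" if "r \<in> R0" "s \<in> R0" "r < s" for r s
      using g[OF that(1)] g[OF that(2)] nxt(3)[OF that(1), of s] that by (auto simp: R0_def)
    have "inj_on g R0" by (rule inj_onI) (metis mono less_irrefl linorder_cases)
    then have cardG: "card R = Suc (card (g ` R0))"
      using fin False card_gt_0_iff[of R] by (simp add: card_image R0_def)
    have GR: "g ` R0 \<inter> R = {}" using g nxt(3) by fastforce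
    have GR': "g ` R0 \<subseteq> R'"
    proof
      fix x assume "x \<in> g ` R0"
      then obtain r where r: "r \<in> R0" "x = g r" by blast
      then show "x \<in> R'" using g[OF r(1)] nxt(1)[OF r(1)] by (auto simp: R_def R'_def R0_def)
    qed
    have pos: "order x (pderiv p) \<ge> 1" if "x \<in> R'" for x
      using that assms by (auto simp: R'_def order_root Suc_le_eq)
    have "root_count \<alpha> \<beta> p = (\<Sum>x\<in>R. Suc (order x (pderiv p)))"
      unfolding root_count_def using ord by (intro sum.cong) (auto simp: R_def)
    also have "\<dots> = (\<Sum>x\<in>R. order x (pderiv p)) + (\<Sum>x\<in>g ` R0. 1) + 1"
      using cardG by (simp add: sum_Suc)
    also have "\<dots> \<le> (\<Sum>x\<in>R. order x (pderiv p)) + (\<Sum>x\<in>g ` R0. order x (pderiv p)) + 1"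
      using pos GR' by (intro add_mono sum_mono) auto
    also have "\<dots> = (\<Sum>x\<in>R \<union> g ` R0. order x (pderiv p)) + 1"
      using fin GR by (subst sum.union_disjoint) (auto simp: R0_def)
    also have "(\<Sum>x\<in>R \<union> g ` R0. order x (pderiv p)) = (\<Sum>x\<in>(R \<union> g ` R0) \<inter> R'. order x (pderiv p))"
      using fin assms GR' by (intro sum.mono_neutral_right) (auto simp: R0_def R_def R'_def order_root)
    also have "\<dots> \<le> root_count \<alpha> \<beta> (pderiv p)"
      unfolding root_count_def R'_def[symmetric] using fin by (intro sum_mono2) auto
    finally show ?thesis by simp
  qed
qed

lemma root_count_le_higher_pderiv:
  assumes "(pderiv ^^ n) p \<noteq> 0"
  shows "root_count \<alpha> \<beta> p \<le> n + root_count \<alpha> \<beta> ((pderiv ^^ n) p)"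
  using assms
proof (induction n)
  case (Suc n)
  then have "(pderiv ^^ n) p \<noteq> 0" by auto
  then show ?case using Suc root_count_le_pderiv[of "(pderiv ^^ n) p" \<alpha> \<beta>] by simp
qed simp

lemma power_dvd_higher_pderiv:
  fixes c p :: "'a::field_char_0 poly"
  assumes "c ^ n dvd p"
  shows "c ^ (n - l) dvd (pderiv ^^ l) p"
proof (induction l)
  case (Suc l)
  have step: "c ^ (i - 1) dvd pderiv r" if dvd: "c ^ i dvd r" for i and r :: "'a poly"
  proof (cases i)
    case (Suc j)
    from dvd obtain s where "r = c ^ Suc j * s" unfolding Suc by (elim dvdE)
    then have "pderiv r = c ^ j * (c * pderiv s + s * smult (of_nat (Suc j)) (pderiv c))"
      by (simp only: pderiv_mult pderiv_power_Suc) (simp add: algebra_simps)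
    then show ?thesis unfolding Suc by simp
  qed auto
  from step[OF Suc.IH] show ?case by simp
qed (use assms in simp)


lemma higher_pderiv_eq_0:
  fixes p :: "'a::field_char_0 poly"
  assumes "degree p < n"
  shows "(pderiv ^^ n) p = 0"
  using assms by (intro poly_eqI) (simp add: coeff_higher_pderiv coeff_eq_0)

lemma higher_pderiv_neq_0:
  fixes p :: "real poly"
  assumes "p \<noteq> 0" "n \<le> degree p"
  shows "(pderiv ^^ n) p \<noteq> 0"
proof
  assume "(pderiv ^^ n) p = 0"
  then have "coeff ((pderiv ^^ n) p) (degree p - n) = 0" by simp
  moreover have "pochhammer (real (Suc (degree p - n))) n > 0" by (intro pochhammer_pos) simp
  ultimately show False using assms by (simp add: coeff_higher_pderiv)
qed

section \<open>Uniqueness of the Pade approximant\<close>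

text \<open>
  This is the homogeneous form of the Pade problem. Put \<open>W = X ^ (m - k) * (1 - a X) ^ r * q\<close>. As \<open>q\<close>
  vanishes at \<open>0\<close>, \<open>W\<close> has a zero of multiplicity \<open>l = m - k + 1\<close> at \<open>0\<close> and one of multiplicity \<open>r\<close>
  at \<open>1 / a\<close>. Differentiating \<open>l\<close> times removes \<open>p\<close> from \<open>W = p + (X + a) ^ m * h\<close>, so that the
  \<open>l\<close>-th derivative of \<open>W\<close> is \<open>(X + a) ^ (k - 1) * T\<close> with \<open>degree T < r\<close>. The factor \<open>X + a\<close> has no
  zero in \<open>[0, 1 / a]\<close>, whereas by Rolle's theorem at least \<open>r\<close> zeros remain there; hence \<open>W = 0\<close>.
\<close>
lemma pade_homogeneous_trivial_real:
  fixes p q :: "real poly" and a :: real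
  assumes a: "a > 0" and km: "1 \<le> k" "k \<le> m" and p: "degree p \<le> m - k" and q: "degree q \<le> k - 1"
    and q0: "poly q 0 = 0"
    and dvd: "[:a, 1:] ^ m dvd p - monom 1 (m - k) * [:1, - a:] ^ r * q"
    and r: "r \<ge> 1"
  shows "p = 0 \<and> q = 0"
proof -
  define W where "W = monom 1 (m - k) * [:1, - a:] ^ r * q"
  have "W = 0"
  proof (rule ccontr)
    assume W: "W \<noteq> 0"
    define l where "l = m - k + 1"
    have qn: "q \<noteq> 0" using W by (auto simp: W_def)
    have degW: "degree W \<le> (m - k) + r + (k - 1)"
    proof -
      have "degree W = (m - k) + r + degree q"
        using qn a by (simp add: W_def degree_mult_eq degree_power_eq degree_monom_eq)
      then show ?thesis using q by simp
    qed
    have "[:0, 1:] dvd q" using q0 poly_eq_0_iff_dvd[of q 0] by simp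
    then obtain q1 where q1: "q = [:0, 1:] * q1" by (elim dvdE)
    have "W = [:- 0, 1:] ^ l * ([:1, - a:] ^ r * q1)"
      unfolding W_def l_def by (simp add: q1 monom_altdef mult_ac)
    then have "[:- 0, 1:] ^ l dvd W" by (rule dvdI)
    then have ord0: "l \<le> order 0 W" using W order_divides by blast
    have "[:1, - a:] = smult (- a) [:- (1 / a), 1:]" using a by simp
    then have "[:1, - a:] ^ r = smult ((- a) ^ r) ([:- (1 / a), 1:] ^ r)" by (simp only: smult_power)
    then have "W = [:- (1 / a), 1:] ^ r * (smult ((- a) ^ r) (monom 1 (m - k) * q))"
      by (simp add: W_def mult_ac)
    then have "[:- (1 / a), 1:] ^ r dvd W" by (rule dvdI)
    then have orda: "r \<le> order (1 / a) W" using W order_divides by blast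
    define V where "V = (pderiv ^^ l) W"
    have "[:- 0, 1:] ^ l dvd W" by fact
    then have "degree ([:- (0::real), 1:] ^ l) \<le> degree W" using W by (intro dvd_imp_degree_le)
    then have "l \<le> degree W" by (simp only: degree_linear_power)
    then have V: "V \<noteq> 0" unfolding V_def using W by (intro higher_pderiv_neq_0)
    have "r + l \<le> root_count 0 (1 / a) W"
    proof -
      have roots: "finite {x. x \<in> {0..1 / a} \<and> poly W x = 0}" using poly_roots_finite[OF W] by simp
      have "poly W 0 = 0" "poly W (1 / a) = 0" using ord0 orda W r by (auto simp: order_root l_def)
      then have "(\<Sum>x\<in>{0, 1 / a}. order x W) \<le> root_count 0 (1 / a) W"
        unfolding root_count_def using a by (intro sum_mono2 roots) auto
      then show ?thesis using ord0 orda a by simp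
    qed
    also have "root_count 0 (1 / a) W \<le> l + root_count 0 (1 / a) V"
      using V unfolding V_def by (rule root_count_le_higher_pderiv)
    finally have many: "r \<le> root_count 0 (1 / a) V" by simp
    have "[:a, 1:] ^ m dvd W - p" using dvd dvd_minus_iff[of "[:a, 1:] ^ m" "p - W"] by (simp add: W_def)
    then have "[:a, 1:] ^ (m - l) dvd (pderiv ^^ l) (W - p)" by (rule power_dvd_higher_pderiv)
    moreover have "(pderiv ^^ l) W = (pderiv ^^ l) (W - p) + (pderiv ^^ l) p"
      by (simp flip: higher_pderiv_add)
    moreover have "(pderiv ^^ l) p = 0" using p by (intro higher_pderiv_eq_0) (simp add: l_def)
    moreover have "m - l = k - 1" using km by (simp add: l_def)
    ultimately have "[:a, 1:] ^ (k - 1) dvd V" by (simp add: V_def)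
    then obtain T where T: "V = [:a, 1:] ^ (k - 1) * T" by (elim dvdE)
    have Tn: "T \<noteq> 0" using V T by auto
    have degV: "degree V = (k - 1) + degree T"
      unfolding T using Tn by (subst degree_mult_eq) (auto simp: degree_power_eq)
    have "degree V = degree W - l" by (simp add: V_def degree_higher_pderiv)
    with degV degW km r have degT: "degree T < r" by (simp add: l_def)
    have "order x V = order x T" if "x \<in> {0..1 / a}" for x
    proof -
      have "poly ([:a, 1:] ^ (k - 1)) x \<noteq> 0" using that a by (simp add: poly_power)
      then have "order x ([:a, 1:] ^ (k - 1)) = 0" by (rule order_0I)
      then show ?thesis using order_mult[of "[:a, 1:] ^ (k - 1)" T x] V T by simp
    qed
    then have "root_count 0 (1 / a) V = (\<Sum>x | x \<in> {0..1 / a} \<and> poly V x = 0. order x T)"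
      by (simp add: root_count_def)
    also have "\<dots> \<le> (\<Sum>x | poly T x = 0. order x T)"
    proof (rule sum_mono2)
      show "{x \<in> {0..1 / a}. poly V x = 0} \<subseteq> {x. poly T x = 0}"
        using a by (auto simp: T poly_power)
    qed (use poly_roots_finite[OF Tn] in auto)
    also have "\<dots> \<le> degree T" using Tn by (rule sum_order_le_degree)
    finally show False using many degT by simp
  qed
  moreover have "monom 1 (m - k) * [:1, - a:] ^ r \<noteq> 0" by (simp add: monom_eq_0_iff)
  ultimately have "q = 0" unfolding W_def using mult_eq_0_iff by blast
  with dvd have "[:a, 1:] ^ m dvd p" by simp
  moreover have "degree ([:a, 1:] ^ m) = m" by (simp add: degree_power_eq)
  ultimately have "p = 0" using dvd_imp_degree_le[of "[:a, 1:] ^ m" p] p km by force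
  with \<open>q = 0\<close> show ?thesis by simp
qed

text \<open>
  Real and imaginary parts of coefficients commute with multiplication by real polynomials. Only powers
  of real linear factors occur, for which an induction suffices.
\<close>
lemma map_poly_linear_real_factor:
  fixes \<phi> :: "complex \<Rightarrow> real"
  assumes "linear \<phi>"
  shows "map_poly \<phi> ([:of_real x, of_real y:] ^ n * q) = [:x, y:] ^ n * map_poly \<phi> q"
proof (induction n)
  case (Suc n)
  have zero: "\<phi> 0 = 0" using assms by (rule linear_0)
  have "map_poly \<phi> ([:of_real x, of_real y:] * r) = [:x, y:] * map_poly \<phi> r" for r
    using linear_add[OF assms] linear_scale[OF assms] zero
    by (intro poly_eqI) (simp add: coeff_map_poly coeff_pCons scaleR_conv_of_real[symmetric] split: nat.split)
  from this[of "[:of_real x, of_real y:] ^ n * q"] show ?case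
    by (simp only: power_Suc mult.assoc Suc.IH)
qed simp

lemma pade_homogeneous_trivial:
  fixes p q :: "complex poly" and a :: real
  assumes a: "a > 0" and km: "1 \<le> k" "k \<le> m" and p: "degree p \<le> m - k" and q: "degree q \<le> k - 1"
    and q0: "poly q 0 = 0"
    and dvd: "[:of_real a, 1:] ^ m dvd p - monom 1 (m - k) * [:1, - of_real a:] ^ r * q"
    and r: "r \<ge> 1"
  shows "p = 0 \<and> q = 0"
proof -
  obtain h where "p - monom 1 (m - k) * [:1, - of_real a:] ^ r * q = [:of_real a, 1:] ^ m * h"
    using dvd by (elim dvdE)
  then have h: "p = [:of_real a, of_real 1:] ^ m * h
      + [:of_real 0, of_real 1:] ^ (m - k) * ([:of_real 1, of_real (- a):] ^ r * q)"
    by (simp add: monom_altdef algebra_simps)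
  have part: "map_poly \<phi> p = 0 \<and> map_poly \<phi> q = 0" if \<phi>: "linear \<phi>" for \<phi> :: "complex \<Rightarrow> real"
  proof (rule pade_homogeneous_trivial_real[OF a km _ _ _ _ r])
    have add: "map_poly \<phi> (u + v) = map_poly \<phi> u + map_poly \<phi> v" for u v
      using \<phi> by (intro poly_eqI) (simp add: coeff_map_poly linear_0 linear_add)
    have "map_poly \<phi> p = [:a, 1:] ^ m * map_poly \<phi> h
        + monom 1 (m - k) * ([:1, - a:] ^ r * map_poly \<phi> q)"
      unfolding h add map_poly_linear_real_factor[OF \<phi>] monom_altdef smult_1_left ..
    then show "[:a, 1:] ^ m dvd map_poly \<phi> p - monom 1 (m - k) * [:1, - a:] ^ r * map_poly \<phi> q"
      by (simp add: mult.assoc)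
    show "poly (map_poly \<phi> q) 0 = 0"
      using q0 by (simp add: poly_0_coeff_0 coeff_map_poly linear_0[OF \<phi>])
    show "degree (map_poly \<phi> p) \<le> m - k" "degree (map_poly \<phi> q) \<le> k - 1"
      using p q by (auto intro!: degree_le simp: coeff_map_poly coeff_eq_0 linear_0[OF \<phi>])
  qed
  have eq0: "u = 0" if "map_poly Re u = 0" "map_poly Im u = 0" for u
    using that by (simp add: poly_eq_iff coeff_map_poly complex_eq_iff)
  have "linear Re" "linear Im" by (simp_all add: bounded_linear.linear bounded_linear_Re bounded_linear_Im)
  then show ?thesis using part[of Re] part[of Im] eq0 by blast
qed

text \<open>
  Were the order \<open>e\<close> of \<open>P\<close> at \<open>c\<close> smaller than \<open>m\<close>, dividing the estimate by \<open>(z - c) ^ e\<close> would show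
  that the cofactor of \<open>(z - c) ^ e\<close> vanishes at \<open>c\<close> as well.
\<close>
lemma linear_power_dvd_if_bigo:
  fixes P :: "complex poly"
  assumes "(\<lambda>z. poly P z) \<in> O[at c](\<lambda>z. (z - c) ^ m)"
  shows "[:- c, 1:] ^ m dvd P"
proof (rule ccontr)
  assume "\<not> [:- c, 1:] ^ m dvd P"
  then have P: "P \<noteq> 0" and e: "order c P < m" by (auto simp: order_divides)
  obtain R where R: "P = [:- c, 1:] ^ order c P * R" "\<not> [:- c, 1:] dvd R"
    using order_decomp[OF P] by blast
  obtain C where C: "\<forall>\<^sub>F z in at c. norm (poly P z) \<le> C * norm ((z - c) ^ m)"
    using assms by (elim landau_o.bigE)
  have "\<forall>\<^sub>F z in at c. z \<noteq> c" by (simp add: eventually_at_filter)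
  with C have "\<forall>\<^sub>F z in at c. norm (poly R z) \<le> C * norm (z - c) ^ (m - order c P)"
  proof eventually_elim
    case (elim z)
    have "norm (z - c) ^ order c P * norm (poly R z) \<le> C * norm (z - c) ^ m"
      using elim(1) by (subst (asm) R(1)) (simp add: poly_power norm_mult norm_power)
    also have "norm (z - c) ^ m = norm (z - c) ^ order c P * norm (z - c) ^ (m - order c P)"
      using e by (simp flip: power_add)
    finally show ?case using elim(2) by (simp add: mult.left_commute)
  qed
  moreover have "((\<lambda>z. C * norm (z - c) ^ (m - order c P)) \<longlongrightarrow> C * norm (c - c) ^ (m - order c P)) (at c)"
    by (intro tendsto_intros)
  moreover have "((\<lambda>z. norm (poly R z)) \<longlongrightarrow> norm (poly R c)) (at c)"
    by (intro tendsto_intros)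
  ultimately have "norm (poly R c) \<le> C * norm (c - c) ^ (m - order c P)"
    by (intro tendsto_le[OF _ _ _]) auto
  then have "poly R c = 0" using e by (simp add: zero_power)
  with R(2) show False by (simp add: poly_eq_0_iff_dvd)
qed

lemma is_pade_unique:
  assumes "0 < a" "1 \<le> k" "k \<le> m" "is_pade N m k a p q" "is_pade N m k a p' q'"
  shows "p = p' \<and> q = q'"
proof -
  note d = assms(4,5)[unfolded is_pade_def]
  have "(\<lambda>z. (poly p z - pade_f N m k a z * poly q z) - (poly p' z - pade_f N m k a z * poly q' z))
      \<in> O[at (- of_real a)](\<lambda>z. (z + of_real a) ^ m)"
    by (rule sum_in_bigo(2)) (use d in auto)
  also have "(\<lambda>z. (poly p z - pade_f N m k a z * poly q z) - (poly p' z - pade_f N m k a z * poly q' z))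
    = poly ((p - p') - monom 1 (m - k) * [:1, - of_real a:] ^ (N - m + 1) * (q - q'))"
    by (simp add: pade_f_def fun_eq_iff poly_monom poly_power algebra_simps)
  finally have "[:of_real a, 1:] ^ m dvd (p - p') - monom 1 (m - k) * [:1, - of_real a:] ^ (N - m + 1) * (q - q')"
    using linear_power_dvd_if_bigo[of _ "- of_real a" m] by simp
  then have "p - p' = 0 \<and> q - q' = 0"
    using assms(1-3) d
    by (intro pade_homogeneous_trivial[of a k m _ _ "N - m + 1"]) (auto intro: degree_diff_le)
  then show ?thesis by simp
qed

section \<open>The Pade approximant from an identity of polynomials\<close>

text \<open>
  The reversal is taken with respect to a prescribed bound \<open>n\<close> on the degree rather than the degree
  itself, because \<open>A\<close> below may have degree smaller than \<open>m - k\<close>.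
\<close>
definition reverse_poly :: "nat \<Rightarrow> 'a::comm_ring_1 poly \<Rightarrow> 'a poly" where
  "reverse_poly n p = (\<Sum>i\<le>n. monom (coeff p (n - i)) i)"

lemma coeff_reverse_poly: "coeff (reverse_poly n p) i = (if i \<le> n then coeff p (n - i) else 0)"
  by (simp add: reverse_poly_def coeff_sum)

lemma degree_reverse_poly_le: "degree (reverse_poly n p) \<le> n"
  by (intro degree_le) (simp add: coeff_reverse_poly)

lemma poly_reverse_poly:
  fixes z :: "'a::field"
  assumes "z \<noteq> 0" "degree p \<le> n"
  shows "poly (reverse_poly n p) z = z ^ n * poly p (1 / z)"
proof -
  have "poly p (1 / z) = (\<Sum>i\<le>n. coeff p i * (1 / z) ^ i)"
    by (subst poly_as_sum_of_monoms'[OF assms(2), symmetric]) (simp add: poly_sum poly_monom)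
  also have "z ^ n * \<dots> = (\<Sum>i\<le>n. coeff p i * z ^ (n - i))"
    using assms(1) by (simp add: sum_distrib_left power_divide power_diff field_simps)
  also have "\<dots> = (\<Sum>i\<le>n. coeff p (n - i) * z ^ i)"
    by (rule sum.reindex_bij_witness[of _ "\<lambda>i. n - i" "\<lambda>i. n - i"]) auto
  finally show ?thesis by (simp add: reverse_poly_def poly_sum poly_monom)
qed

text \<open>
  Evaluate the identity at \<open>1 / z\<close> and multiply by \<open>z ^ N\<close>. The exponents \<open>N = (N - m + k) + (m - k)\<close>,
  \<open>N = (N - m + 1) + (k - 1) + (m - k)\<close> and \<open>N = (N - m) + m\<close> distribute this power over the three
  terms, which become \<open>p\<close>, \<open>f * q\<close> and a polynomial multiple of \<open>(z + a) ^ m\<close>.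
\<close>
lemma pade_kappa_eq:
  fixes A S Q :: "complex poly"
  assumes a: "0 < a" and mk: "1 \<le> k" "k \<le> m" "m \<le> N"
    and deg: "degree A \<le> m - k" "degree S \<le> k - 1" "degree Q \<le> N - m" and S: "coeff S (k - 1) = 1"
    and eq: "monom 1 (N - m + k) * A
               = [:- of_real a, 1:] ^ (N - m + 1) * S - Q * [:1, of_real a:] ^ m"
  shows "pade_kappa N m k a = coeff A 0"
proof -
  define p q T where "p = reverse_poly (m - k) A" and "q = reverse_poly (k - 1) S"
    and "T = reverse_poly (N - m) Q"
  have id: "poly p z - pade_f N m k a z * poly q z = - poly T z * (z + of_real a) ^ m" if z: "z \<noteq> 0" for z
  proof -
    have "N = (N - m + k) + (m - k)" "N = (N - m + 1) + (k - 1) + (m - k)" "N = (N - m) + m"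
      using mk by auto
    then have N: "z ^ N = z ^ (N - m + k) * z ^ (m - k)"
        "z ^ N = z ^ (N - m + 1) * z ^ (k - 1) * z ^ (m - k)" "z ^ N = z ^ (N - m) * z ^ m"
      by (metis power_add)+
    have "poly p z = z ^ N * (1 / z) ^ (N - m + k) * poly A (1 / z)"
      unfolding p_def N(1) using z deg by (simp add: poly_reverse_poly power_divide del: power_add)
    also have "\<dots> = z ^ N * poly (monom 1 (N - m + k) * A) (1 / z)" by (simp add: poly_monom)
    also have "\<dots> = z ^ N * (1 / z - of_real a) ^ (N - m + 1) * poly S (1 / z)
         - z ^ N * poly Q (1 / z) * (1 + of_real a / z) ^ m"
      unfolding eq by (simp add: poly_power algebra_simps del: power_add)
    also have "z ^ N * (1 / z - of_real a) ^ (N - m + 1) * poly S (1 / z)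
        = z ^ (m - k) * (z * (1 / z - of_real a)) ^ (N - m + 1) * (z ^ (k - 1) * poly S (1 / z))"
      unfolding N(2) by (simp only: power_mult_distrib mult_ac)
    also have "z * (1 / z - of_real a) = 1 - of_real a * z" using z by (simp add: field_simps)
    also have "z ^ N * poly Q (1 / z) * (1 + of_real a / z) ^ m
        = (z ^ (N - m) * poly Q (1 / z)) * (z * (1 + of_real a / z)) ^ m"
      unfolding N(3) by (simp only: power_mult_distrib mult_ac)
    also have "z * (1 + of_real a / z) = z + of_real a" using z by (simp add: field_simps)
    finally show ?thesis
      unfolding q_def T_def using z deg by (simp add: poly_reverse_poly pade_f_def)
  qed
  have pade: "is_pade N m k a p q"
    unfolding is_pade_def
  proof (intro conjI)
    show "degree p \<le> m - k" "degree q \<le> k - 1" 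
      by (simp_all only: p_def q_def degree_reverse_poly_le)
    show "poly q 0 = 1" using S by (simp add: q_def poly_0_coeff_0 coeff_reverse_poly)
    show "(\<lambda>z. poly p z - pade_f N m k a z * poly q z) \<in> O[at (- of_real a)](\<lambda>z. (z + of_real a) ^ m)"
    proof (rule bigoI_tendsto)
      have "\<forall>\<^sub>F z in at (- complex_of_real a). z \<noteq> 0"
        using a by (intro eventually_neq_at_within) 
      moreover have ne: "\<forall>\<^sub>F z in at (- complex_of_real a). z \<noteq> - of_real a"
        by (rule eventually_neq_at_within)
      ultimately have ev: "\<forall>\<^sub>F z in at (- complex_of_real a).
          - poly T z = (poly p z - pade_f N m k a z * poly q z) / (z + of_real a) ^ m"
      proof eventually_elim
        case (elim z)
        then have "z + of_real a \<noteq> 0" by (simp add: eq_neg_iff_add_eq_0)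
        then show ?case using id[OF elim(1)] by simp
      qed
      have "((\<lambda>z. - poly T z) \<longlongrightarrow> - poly T (- of_real a)) (at (- complex_of_real a))"
        by (intro tendsto_intros)
      then show "((\<lambda>z. (poly p z - pade_f N m k a z * poly q z) / (z + of_real a) ^ m) \<longlongrightarrow> - poly T (- of_real a))
          (at (- complex_of_real a))"
        using ev by (rule Lim_transform_eventually)
      show "\<forall>\<^sub>F z in at (- complex_of_real a). (z + of_real a) ^ m \<noteq> 0"
        using ne by eventually_elim (simp add: eq_neg_iff_add_eq_0)
    qed
  qed
  have "pade_pair N m k a = (p, q)"
    unfolding pade_pair_def
  proof (rule the_equality)
    show "case (p, q) of (p, q) \<Rightarrow> is_pade N m k a p q" using pade by simp
    show "pq = (p, q)" if "case pq of (p, q) \<Rightarrow> is_pade N m k a p q" for pq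
      using that is_pade_unique[OF a mk(1,2) _ pade, of "fst pq" "snd pq"]
      by (simp add: case_prod_unfold prod_eq_iff)
  qed
  then show ?thesis by (simp add: pade_kappa_def p_def coeff_reverse_poly)
qed

section \<open>The first row of the Riemann-Hilbert problem\<close>

lemma entire_bigo_power_imp_poly:
  fixes f :: "complex \<Rightarrow> complex"
  assumes "f holomorphic_on UNIV" "f \<in> O[at_infinity](\<lambda>z. z ^ n)"
  obtains P where "degree P \<le> n" "\<And>z. f z = poly P z"
proof -
  obtain C where "\<forall>\<^sub>F z in at_infinity. norm (f z) \<le> C * norm (z ^ n)"
    using assms(2) by (elim landau_o.bigE)
  then obtain B where B: "\<And>z. B \<le> norm z \<Longrightarrow> norm (f z) \<le> C * norm z ^ n"
    by (auto simp: eventually_at_infinity norm_power)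
  define P where "P = (\<Sum>k\<le>n. monom ((deriv ^^ k) f 0 / fact k) k)"
  show ?thesis
  proof (rule that)
    show "degree P \<le> n" unfolding P_def by (intro degree_sum_le) (auto intro: order_trans[OF degree_monom_le])
    show "f z = poly P z" for z
      using Liouville_polynomial[OF assms(1) B, where \<xi> = z] by (simp add: P_def poly_sum poly_monom)
  qed
qed

lemma has_jump_first_row:
  fixes U J :: "complex \<Rightarrow> complex^2^2" and \<gamma> :: "real \<Rightarrow> complex"
  assumes "has_jump U \<gamma> J"
  obtains up um vp vm :: "complex \<Rightarrow> complex" where
    "continuous_on (path_image \<gamma>) up" "continuous_on (path_image \<gamma>) um"
    "continuous_on (path_image \<gamma>) vp" "continuous_on (path_image \<gamma>) vm"
    "\<forall>\<zeta>\<in>path_image \<gamma>. ((\<lambda>z. U z $ 1 $ 1) \<longlongrightarrow> up \<zeta>) (at \<zeta> within inside (path_image \<gamma>))"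
    "\<forall>\<zeta>\<in>path_image \<gamma>. ((\<lambda>z. U z $ 1 $ 1) \<longlongrightarrow> um \<zeta>) (at \<zeta> within outside (path_image \<gamma>))"
    "\<forall>\<zeta>\<in>path_image \<gamma>. ((\<lambda>z. U z $ 1 $ 2) \<longlongrightarrow> vp \<zeta>) (at \<zeta> within inside (path_image \<gamma>))"
    "\<forall>\<zeta>\<in>path_image \<gamma>. ((\<lambda>z. U z $ 1 $ 2) \<longlongrightarrow> vm \<zeta>) (at \<zeta> within outside (path_image \<gamma>))"
    "\<forall>\<zeta>\<in>path_image \<gamma>. up \<zeta> = um \<zeta> * J \<zeta> $ 1 $ 1 + vm \<zeta> * J \<zeta> $ 2 $ 1"
    "\<forall>\<zeta>\<in>path_image \<gamma>. vp \<zeta> = um \<zeta> * J \<zeta> $ 1 $ 2 + vm \<zeta> * J \<zeta> $ 2 $ 2"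
proof -
  from assms obtain Up Um where U: "continuous_on (path_image \<gamma>) Up" "continuous_on (path_image \<gamma>) Um"
    "\<And>\<zeta>. \<zeta> \<in> path_image \<gamma> \<Longrightarrow> (U \<longlongrightarrow> Up \<zeta>) (at \<zeta> within inside (path_image \<gamma>))"
    "\<And>\<zeta>. \<zeta> \<in> path_image \<gamma> \<Longrightarrow> (U \<longlongrightarrow> Um \<zeta>) (at \<zeta> within outside (path_image \<gamma>))"
    "\<And>\<zeta>. \<zeta> \<in> path_image \<gamma> \<Longrightarrow> Up \<zeta> = Um \<zeta> ** J \<zeta>"
    unfolding has_jump_def by blast
  show ?thesis
  proof (rule that[of "\<lambda>\<zeta>. Up \<zeta> $ 1 $ 1" "\<lambda>\<zeta>. Um \<zeta> $ 1 $ 1" "\<lambda>\<zeta>. Up \<zeta> $ 1 $ 2" "\<lambda>\<zeta>. Um \<zeta> $ 1 $ 2"])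
    show "continuous_on (path_image \<gamma>) (\<lambda>\<zeta>. Up \<zeta> $ 1 $ 1)"
      "continuous_on (path_image \<gamma>) (\<lambda>\<zeta>. Um \<zeta> $ 1 $ 1)"
      "continuous_on (path_image \<gamma>) (\<lambda>\<zeta>. Up \<zeta> $ 1 $ 2)"
      "continuous_on (path_image \<gamma>) (\<lambda>\<zeta>. Um \<zeta> $ 1 $ 2)"
      by (intro continuous_on_component U)+
    show "\<forall>\<zeta>\<in>path_image \<gamma>. ((\<lambda>z. U z $ 1 $ 1) \<longlongrightarrow> Up \<zeta> $ 1 $ 1) (at \<zeta> within inside (path_image \<gamma>))"
      "\<forall>\<zeta>\<in>path_image \<gamma>. ((\<lambda>z. U z $ 1 $ 1) \<longlongrightarrow> Um \<zeta> $ 1 $ 1) (at \<zeta> within outside (path_image \<gamma>))"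
      "\<forall>\<zeta>\<in>path_image \<gamma>. ((\<lambda>z. U z $ 1 $ 2) \<longlongrightarrow> Up \<zeta> $ 1 $ 2) (at \<zeta> within inside (path_image \<gamma>))"
      "\<forall>\<zeta>\<in>path_image \<gamma>. ((\<lambda>z. U z $ 1 $ 2) \<longlongrightarrow> Um \<zeta> $ 1 $ 2) (at \<zeta> within outside (path_image \<gamma>))"
      by (intro ballI tendsto_vec_nth U; assumption)+
    show "\<forall>\<zeta>\<in>path_image \<gamma>. Up \<zeta> $ 1 $ 1 = Um \<zeta> $ 1 $ 1 * J \<zeta> $ 1 $ 1 + Um \<zeta> $ 1 $ 2 * J \<zeta> $ 2 $ 1"
      "\<forall>\<zeta>\<in>path_image \<gamma>. Up \<zeta> $ 1 $ 2 = Um \<zeta> $ 1 $ 1 * J \<zeta> $ 1 $ 2 + Um \<zeta> $ 1 $ 2 * J \<zeta> $ 2 $ 2"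
      using U(5) by (simp_all add: matrix_matrix_mult_def sum_2)
  qed
qed

text \<open>
  The product bound \<open>z ^ n * (1 / z)\<close> and \<open>z ^ (n - 1)\<close> differ as functions only at \<open>0\<close>, when \<open>n = 1\<close>.
\<close>
lemma bigo_power_mult_decay:
  fixes f g :: "complex \<Rightarrow> complex"
  assumes "f \<in> O[at_infinity](\<lambda>z. z ^ n)" "g \<in> O[at_infinity](\<lambda>z. 1 / z)" "1 \<le> n"
  shows "(\<lambda>z. f z * g z) \<in> O[at_infinity](\<lambda>z. z ^ (n - 1))"
proof -
  have "(\<lambda>z. f z * g z) \<in> O[at_infinity](\<lambda>z. z ^ n * (1 / z))"
    using assms by (intro landau_o.big.mult)
  also have "(\<lambda>z. z ^ n * (1 / z)) \<in> O[at_infinity](\<lambda>z::complex. z ^ (n - 1))"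
  proof (rule bigoI[where c = 1], rule always_eventually, rule allI)
    show "norm (z ^ n * (1 / z)) \<le> 1 * norm (z ^ (n - 1))" for z :: complex
      using assms(3) by (cases "z = 0"; cases n) auto
  qed
  finally show ?thesis .
qed

lemma linear_power_dvd_if_factor:
  fixes P :: "complex poly"
  assumes "open S" "c \<in> S" "g holomorphic_on S" "\<And>z. z \<in> S \<Longrightarrow> poly P z = (z - c) ^ n * g z"
  shows "[:- c, 1:] ^ n dvd P"
proof (rule linear_power_dvd_if_bigo, rule bigoI_tendsto)
  have lim: "(g \<longlongrightarrow> g c) (at c)"
    using assms by (meson continuous_on_eq_continuous_at holomorphic_on_imp_continuous_on isCont_def)
  have ne: "\<forall>\<^sub>F z in at c. z \<noteq> c" by (rule eventually_neq_at_within)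
  have "\<forall>\<^sub>F z in at c. z \<in> S" using assms by (intro eventually_at_in_open')
  with ne have "\<forall>\<^sub>F z in at c. g z = poly P z / (z - c) ^ n"
    by eventually_elim (simp add: assms(4))
  with lim show "((\<lambda>z. poly P z / (z - c) ^ n) \<longlongrightarrow> g c) (at c)"
    by (rule Lim_transform_eventually)
  show "\<forall>\<^sub>F z in at c. (z - c) ^ n \<noteq> 0" using ne by eventually_elim simp
qed

text \<open>
  The conditions on the first row \<open>(u, v)\<close> of a solution, with the powers of \<open>z\<close> and \<open>z - a\<close> and the
  two occurrences of \<open>a\<close> abstracted to parameters. The suffixes \<open>1p\<close>, \<open>1m\<close>, \<open>2p\<close>, \<open>2m\<close> denote the
  boundary values from the inside (plus) and the outside (minus) of each contour.
\<close>
locale first_row_rhp =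
  fixes \<gamma>1 \<gamma>2 :: "real \<Rightarrow> complex" and \<alpha> \<beta> :: complex and r m M :: nat
    and u v u1p u1m v1p v1m u2p u2m v2p v2m :: "complex \<Rightarrow> complex"
  assumes \<gamma>1: "valid_path \<gamma>1" "simple_path \<gamma>1" "pathfinish \<gamma>1 = pathstart \<gamma>1"
    and \<gamma>2: "valid_path \<gamma>2" "simple_path \<gamma>2" "pathfinish \<gamma>2 = pathstart \<gamma>2"
    and \<alpha>: "\<alpha> \<in> inside (path_image \<gamma>1)"
    and \<beta>: "\<And>z. 1 + \<beta> * z = 0 \<Longrightarrow> z \<in> outside (path_image \<gamma>1)"
    and nested: "path_image \<gamma>1 \<subseteq> inside (path_image \<gamma>2)"
    and zero: "0 \<in> inside (path_image \<gamma>2)"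
    and exponents: "1 \<le> r" "1 \<le> M"
    and holo_u: "u holomorphic_on - (path_image \<gamma>1 \<union> path_image \<gamma>2)"
    and holo_v: "v holomorphic_on - (path_image \<gamma>1 \<union> path_image \<gamma>2)"
    and u_inf: "(\<lambda>z. u z - 1) \<in> O[at_infinity](\<lambda>z. 1 / z)"
    and v_inf: "v \<in> O[at_infinity](\<lambda>z. 1 / z)"
    and cont1: "continuous_on (path_image \<gamma>1) u1p" "continuous_on (path_image \<gamma>1) v1m"
    and cont2: "continuous_on (path_image \<gamma>2) u2m" "continuous_on (path_image \<gamma>2) v2m"
    and lim1: "\<And>\<zeta>. \<zeta> \<in> path_image \<gamma>1 \<Longrightarrow> (u \<longlongrightarrow> u1p \<zeta>) (at \<zeta> within inside (path_image \<gamma>1))"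
      "\<And>\<zeta>. \<zeta> \<in> path_image \<gamma>1 \<Longrightarrow> (u \<longlongrightarrow> u1m \<zeta>) (at \<zeta> within outside (path_image \<gamma>1))"
      "\<And>\<zeta>. \<zeta> \<in> path_image \<gamma>1 \<Longrightarrow> (v \<longlongrightarrow> v1p \<zeta>) (at \<zeta> within inside (path_image \<gamma>1))"
      "\<And>\<zeta>. \<zeta> \<in> path_image \<gamma>1 \<Longrightarrow> (v \<longlongrightarrow> v1m \<zeta>) (at \<zeta> within outside (path_image \<gamma>1))"
    and lim2: "\<And>\<zeta>. \<zeta> \<in> path_image \<gamma>2 \<Longrightarrow> (u \<longlongrightarrow> u2p \<zeta>) (at \<zeta> within inside (path_image \<gamma>2))"
      "\<And>\<zeta>. \<zeta> \<in> path_image \<gamma>2 \<Longrightarrow> (u \<longlongrightarrow> u2m \<zeta>) (at \<zeta> within outside (path_image \<gamma>2))"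
      "\<And>\<zeta>. \<zeta> \<in> path_image \<gamma>2 \<Longrightarrow> (v \<longlongrightarrow> v2p \<zeta>) (at \<zeta> within inside (path_image \<gamma>2))"
      "\<And>\<zeta>. \<zeta> \<in> path_image \<gamma>2 \<Longrightarrow> (v \<longlongrightarrow> v2m \<zeta>) (at \<zeta> within outside (path_image \<gamma>2))"
    and jump1: "\<And>\<zeta>. \<zeta> \<in> path_image \<gamma>1 \<Longrightarrow> u1p \<zeta> = u1m \<zeta>"
      "\<And>\<zeta>. \<zeta> \<in> path_image \<gamma>1 \<Longrightarrow>
         v1p \<zeta> = u1m \<zeta> * (\<zeta> ^ M / ((\<zeta> - \<alpha>) ^ r * (1 + \<beta> * \<zeta>) ^ m)) + v1m \<zeta>"
    and jump2: "\<And>\<zeta>. \<zeta> \<in> path_image \<gamma>2 \<Longrightarrow>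
         u2p \<zeta> = u2m \<zeta> - v2m \<zeta> * ((\<zeta> - \<alpha>) ^ r * (1 + \<beta> * \<zeta>) ^ m / \<zeta> ^ M)"
      "\<And>\<zeta>. \<zeta> \<in> path_image \<gamma>2 \<Longrightarrow> v2p \<zeta> = v2m \<zeta>"
begin

abbreviation "\<Gamma>1 \<equiv> path_image \<gamma>1"
abbreviation "\<Gamma>2 \<equiv> path_image \<gamma>2"

lemma open_sides: "open (inside \<Gamma>1)" "open (outside \<Gamma>1)" "open (inside \<Gamma>2)" "open (outside \<Gamma>2)"
  using \<gamma>1 \<gamma>2 by (simp_all add: open_inside open_outside closed_valid_path_image)

text \<open>
  The complement of the interior of the outer contour is the closure of its exterior; it is connected,
  unbounded and disjoint from the inner contour, and so lies in the exterior of the inner contour.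
\<close>
lemma inside_nested: "inside \<Gamma>1 \<subseteq> inside \<Gamma>2"
proof (rule order_trans[OF inside_subset])
  have J: "connected (outside \<Gamma>2)" "\<not> bounded (outside \<Gamma>2)" "frontier (outside \<Gamma>2) = \<Gamma>2"
    using Jordan_inside_outside[OF \<gamma>2(2,3)] by auto
  then have "closure (outside \<Gamma>2) = outside \<Gamma>2 \<union> \<Gamma>2" by (metis closure_Un_frontier)
  then show "connected (outside \<Gamma>2 \<union> \<Gamma>2)" using J connected_imp_connected_closure by metis
  show "\<not> bounded (outside \<Gamma>2 \<union> \<Gamma>2)" using J(2) by auto
  have "outside \<Gamma>2 \<union> \<Gamma>2 = - inside \<Gamma>2" 
    using inside_Un_outside[of \<Gamma>2] inside_Int_outside[of \<Gamma>2] inside_no_overlap[of \<Gamma>2] by blast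
  then show "(inside \<Gamma>2 - \<Gamma>1) \<union> (outside \<Gamma>2 \<union> \<Gamma>2) = - \<Gamma>1" using nested by auto
qed auto

lemma sides:
  "z \<in> inside \<Gamma>1 \<or> z \<in> \<Gamma>1 \<or> z \<in> outside \<Gamma>1" "z \<in> inside \<Gamma>2 \<or> z \<in> \<Gamma>2 \<or> z \<in> outside \<Gamma>2"
  "\<not> (z \<in> inside \<Gamma>1 \<and> z \<in> \<Gamma>1)" "\<not> (z \<in> outside \<Gamma>1 \<and> z \<in> \<Gamma>1)" "\<not> (z \<in> inside \<Gamma>1 \<and> z \<in> outside \<Gamma>1)"
  "\<not> (z \<in> inside \<Gamma>2 \<and> z \<in> \<Gamma>2)" "\<not> (z \<in> outside \<Gamma>2 \<and> z \<in> \<Gamma>2)" "\<not> (z \<in> inside \<Gamma>2 \<and> z \<in> outside \<Gamma>2)"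
  "z \<in> \<Gamma>1 \<Longrightarrow> z \<in> inside \<Gamma>2" "z \<in> inside \<Gamma>1 \<Longrightarrow> z \<in> inside \<Gamma>2"
proof -
  have three: "z \<in> inside X \<or> z \<in> X \<or> z \<in> outside X" "\<not> (z \<in> inside X \<and> z \<in> X)"
    "\<not> (z \<in> outside X \<and> z \<in> X)" "\<not> (z \<in> inside X \<and> z \<in> outside X)" for X :: "complex set"
    using inside_Un_outside[of X] inside_no_overlap[of X] outside_no_overlap[of X] inside_Int_outside[of X]
    by blast+
  show "z \<in> inside \<Gamma>1 \<or> z \<in> \<Gamma>1 \<or> z \<in> outside \<Gamma>1" "z \<in> inside \<Gamma>2 \<or> z \<in> \<Gamma>2 \<or> z \<in> outside \<Gamma>2"
    "\<not> (z \<in> inside \<Gamma>1 \<and> z \<in> \<Gamma>1)" "\<not> (z \<in> outside \<Gamma>1 \<and> z \<in> \<Gamma>1)" "\<not> (z \<in> inside \<Gamma>1 \<and> z \<in> outside \<Gamma>1)"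
    "\<not> (z \<in> inside \<Gamma>2 \<and> z \<in> \<Gamma>2)" "\<not> (z \<in> outside \<Gamma>2 \<and> z \<in> \<Gamma>2)" "\<not> (z \<in> inside \<Gamma>2 \<and> z \<in> outside \<Gamma>2)"
    by (rule three)+
  show "z \<in> \<Gamma>1 \<Longrightarrow> z \<in> inside \<Gamma>2" using nested by (rule subsetD)
  show "z \<in> inside \<Gamma>1 \<Longrightarrow> z \<in> inside \<Gamma>2" using inside_nested by (rule subsetD)
qed

lemma outside_of_inner:
  assumes "z \<notin> inside \<Gamma>2"
  shows "z \<in> outside \<Gamma>1"
  using assms sides(1,9,10)[of z] by blast

lemma outside_outer: "z \<in> outside \<Gamma>2 \<Longrightarrow> z \<in> outside \<Gamma>1 \<and> z \<notin> \<Gamma>2 \<and> z \<notin> inside \<Gamma>2"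
  using sides(7,8)[of z] outside_of_inner[of z] by blast

lemma denominator_nonzero: "z \<in> inside \<Gamma>1 \<Longrightarrow> 1 + \<beta> * z \<noteq> 0"
  using \<beta> sides(5) by blast

lemma eventually_outside_outer: "\<forall>\<^sub>F z in at_infinity. z \<in> outside \<Gamma>2"
proof -
  have "bounded (- outside \<Gamma>2)"
    using Jordan_inside_outside[OF \<gamma>2(2,3)] bounded_simple_path_image[OF \<gamma>2(2)] sides
    by (metis (no_types, opaque_lifting) ComplD UnI1 UnI2 bounded_Un bounded_subset subsetI)
  then obtain B where "\<And>z. z \<notin> outside \<Gamma>2 \<Longrightarrow> norm z \<le> B" unfolding bounded_iff by blast
  then have "z \<in> outside \<Gamma>2" if "B + 1 \<le> norm z" for z using that by force
  then show ?thesis unfolding eventually_at_infinity by blast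
qed

lemma extend_u:
  obtains A where "A holomorphic_on inside \<Gamma>2" "\<And>z. z \<in> \<Gamma>1 \<Longrightarrow> A z = u1p z" "\<And>z. z \<notin> \<Gamma>1 \<Longrightarrow> A z = u z"
proof -
  define A where "A z = (if z \<in> \<Gamma>1 then u1p z else u z)" for z
  have "A holomorphic_on inside \<Gamma>2"
    unfolding A_def
  proof (rule holomorphic_glue_across_contour[OF \<gamma>1(1,2) open_sides(3) _ cont1(1)])
    show "u holomorphic_on inside \<Gamma>2 - \<Gamma>1" 
      by (rule holomorphic_on_subset[OF holo_u]) (use sides in blast)
    show "(u \<longlongrightarrow> u1p \<zeta>) (at \<zeta> within inside \<Gamma>1)" if "\<zeta> \<in> \<Gamma>1" for \<zeta> using lim1(1) that .
    show "(u \<longlongrightarrow> u1p \<zeta>) (at \<zeta> within outside \<Gamma>1)" if "\<zeta> \<in> \<Gamma>1" for \<zeta> using lim1(2) that jump1(1) by simp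
  qed
  then show ?thesis by (rule that) (simp_all add: A_def)
qed

lemma eventually_outside_of_inner:
  assumes "\<zeta> \<in> \<Gamma>2"
  shows "\<forall>\<^sub>F z in at \<zeta> within X. z \<in> outside \<Gamma>1"
proof -
  have "\<zeta> \<in> outside \<Gamma>1" using assms sides outside_of_inner by blast
  then have "\<forall>\<^sub>F z in nhds \<zeta>. z \<in> outside \<Gamma>1" using open_sides(2) by (rule eventually_nhds_in_open[rotated])
  then show ?thesis by (auto simp: eventually_at_filter elim: eventually_mono)
qed

text \<open>
  Multiplying by \<open>(z - \<alpha>) ^ r\<close> removes the pole of the weight inside the inner contour, so that the
  jump of \<open>v\<close> there is the boundary value of a function analytic in its interior. Subtracting that function
  leaves no jump; the outer contour imposes none on \<open>v\<close>.
\<close>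
lemma polynomial_Q:
  assumes A: "A holomorphic_on inside \<Gamma>2" "\<And>z. z \<in> \<Gamma>1 \<Longrightarrow> A z = u1p z"
  obtains Q where "degree Q \<le> r - 1"
    "\<And>z. z \<in> inside \<Gamma>1 \<Longrightarrow> poly Q z = (z - \<alpha>) ^ r * v z - z ^ M / (1 + \<beta> * z) ^ m * A z"
    "\<And>\<zeta>. \<zeta> \<in> \<Gamma>2 \<Longrightarrow> poly Q \<zeta> = (\<zeta> - \<alpha>) ^ r * v2m \<zeta>"
proof -
  have contA: "isCont A z" if "z \<in> inside \<Gamma>2" for z
    using A(1) open_sides(3) that by (meson continuous_on_eq_continuous_at holomorphic_on_imp_continuous_on)
  define G0 where "G0 z = (z - \<alpha>) ^ r * v z - (if z \<in> inside \<Gamma>1 then z ^ M / (1 + \<beta> * z) ^ m * A z else 0)" for z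
  define G1 where "G1 z = (if z \<in> \<Gamma>1 then (z - \<alpha>) ^ r * v1m z else G0 z)" for z
  define G2 where "G2 z = (if z \<in> \<Gamma>2 then (z - \<alpha>) ^ r * v2m z else G1 z)" for z
  have "G0 holomorphic_on inside \<Gamma>1 \<union> (outside \<Gamma>1 - \<Gamma>2)"
  proof (rule holomorphic_on_Un)
    have "(\<lambda>z. (z - \<alpha>) ^ r * v z - z ^ M / (1 + \<beta> * z) ^ m * A z) holomorphic_on inside \<Gamma>1"
      using sides denominator_nonzero
      by (intro holomorphic_intros holomorphic_on_subset[OF holo_v] holomorphic_on_subset[OF A(1)]) auto
    then show "G0 holomorphic_on inside \<Gamma>1" by (rule holomorphic_transform) (simp add: G0_def)
    have "(\<lambda>z. (z - \<alpha>) ^ r * v z) holomorphic_on outside \<Gamma>1 - \<Gamma>2"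
      using sides by (intro holomorphic_intros holomorphic_on_subset[OF holo_v]) auto
    then show "G0 holomorphic_on outside \<Gamma>1 - \<Gamma>2"
      by (rule holomorphic_transform) (use sides in \<open>auto simp: G0_def\<close>)
  qed (use open_sides \<gamma>2 in \<open>auto intro!: open_Diff closed_valid_path_image\<close>)
  then have G0: "G0 holomorphic_on - \<Gamma>2 - \<Gamma>1"
    by (rule holomorphic_on_subset) (use sides in blast)
  have "G1 holomorphic_on - \<Gamma>2"
    unfolding G1_def
  proof (rule holomorphic_glue_across_contour[OF \<gamma>1(1,2) _ G0])
    show "open (- \<Gamma>2)" using \<gamma>2 by (simp add: open_Compl closed_valid_path_image)
    show "continuous_on \<Gamma>1 (\<lambda>z. (z - \<alpha>) ^ r * v1m z)" by (intro continuous_intros cont1)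
    fix \<zeta> assume \<zeta>: "\<zeta> \<in> \<Gamma>1"
    have ne: "\<zeta> \<noteq> \<alpha>" "1 + \<beta> * \<zeta> \<noteq> 0" using \<zeta> \<alpha> \<beta> sides by blast+
    have Alim: "(A \<longlongrightarrow> u1m \<zeta>) (at \<zeta> within inside \<Gamma>1)"
      using contA[of \<zeta>] A(2)[OF \<zeta>] jump1(1)[OF \<zeta>] sides(9)[OF \<zeta>]
      by (metis continuous_at_imp_continuous_at_within continuous_within)
    have "((\<lambda>z. (z - \<alpha>) ^ r * v z - z ^ M / (1 + \<beta> * z) ^ m * A z)
       \<longlongrightarrow> (\<zeta> - \<alpha>) ^ r * v1p \<zeta> - \<zeta> ^ M / (1 + \<beta> * \<zeta>) ^ m * u1m \<zeta>) (at \<zeta> within inside \<Gamma>1)"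
      using ne by (intro tendsto_intros lim1(3) \<zeta> Alim) auto
    also have "(\<zeta> - \<alpha>) ^ r * v1p \<zeta> - \<zeta> ^ M / (1 + \<beta> * \<zeta>) ^ m * u1m \<zeta> = (\<zeta> - \<alpha>) ^ r * v1m \<zeta>"
      using ne unfolding jump1(2)[OF \<zeta>] by (simp add: field_simps)
    finally show "(G0 \<longlongrightarrow> (\<zeta> - \<alpha>) ^ r * v1m \<zeta>) (at \<zeta> within inside \<Gamma>1)"
      by (rule Lim_transform_eventually) (auto simp: eventually_at_filter G0_def)
    have "((\<lambda>z. (z - \<alpha>) ^ r * v z) \<longlongrightarrow> (\<zeta> - \<alpha>) ^ r * v1m \<zeta>) (at \<zeta> within outside \<Gamma>1)"
      by (intro tendsto_intros lim1(4) \<zeta>)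
    then show "(G0 \<longlongrightarrow> (\<zeta> - \<alpha>) ^ r * v1m \<zeta>) (at \<zeta> within outside \<Gamma>1)"
      by (rule Lim_transform_eventually) (use sides in \<open>auto simp: eventually_at_filter G0_def\<close>)
  qed
  then have G1: "G1 holomorphic_on UNIV - \<Gamma>2" by (simp add: Compl_eq_Diff_UNIV)
  have G1_out: "G1 z = (z - \<alpha>) ^ r * v z" if "z \<in> outside \<Gamma>1" for z
    using that sides by (auto simp: G1_def G0_def)
  have "G2 holomorphic_on UNIV"
    unfolding G2_def
  proof (rule holomorphic_glue_across_contour[OF \<gamma>2(1,2) _ G1])
    show "continuous_on \<Gamma>2 (\<lambda>z. (z - \<alpha>) ^ r * v2m z)" by (intro continuous_intros cont2)
    fix \<zeta> assume \<zeta>: "\<zeta> \<in> \<Gamma>2"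
    have near: "\<forall>\<^sub>F z in at \<zeta> within X. (z - \<alpha>) ^ r * v z = G1 z" for X
      using eventually_outside_of_inner[OF \<zeta>] by eventually_elim (simp add: G1_out)
    have "((\<lambda>z. (z - \<alpha>) ^ r * v z) \<longlongrightarrow> (\<zeta> - \<alpha>) ^ r * v2p \<zeta>) (at \<zeta> within inside \<Gamma>2)"
      by (intro tendsto_intros lim2(3) \<zeta>)
    then show "(G1 \<longlongrightarrow> (\<zeta> - \<alpha>) ^ r * v2m \<zeta>) (at \<zeta> within inside \<Gamma>2)"
      unfolding jump2(2)[OF \<zeta>] by (rule Lim_transform_eventually[OF _ near])
    have "((\<lambda>z. (z - \<alpha>) ^ r * v z) \<longlongrightarrow> (\<zeta> - \<alpha>) ^ r * v2m \<zeta>) (at \<zeta> within outside \<Gamma>2)"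
      by (intro tendsto_intros lim2(4) \<zeta>)
    then show "(G1 \<longlongrightarrow> (\<zeta> - \<alpha>) ^ r * v2m \<zeta>) (at \<zeta> within outside \<Gamma>2)"
      by (rule Lim_transform_eventually[OF _ near])
  qed auto
  moreover have "G2 \<in> O[at_infinity](\<lambda>z. z ^ (r - 1))"
  proof -
    have "(\<lambda>z. z - \<alpha>) \<in> O[at_infinity](\<lambda>z. z)"
    proof (rule bigoI[where c = 2])
      have "norm (z - \<alpha>) \<le> 2 * norm z" if "norm \<alpha> \<le> norm z" for z
        using norm_triangle_ineq4[of z \<alpha>] that by simp
      then show "\<forall>\<^sub>F z in at_infinity. norm (z - \<alpha>) \<le> 2 * norm z"
        unfolding eventually_at_infinity by blast
    qed
    then have "(\<lambda>z. (z - \<alpha>) ^ r * v z) \<in> O[at_infinity](\<lambda>z. z ^ (r - 1))"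
      by (intro bigo_power_mult_decay landau_o.big_power v_inf exponents)
    also have "(\<lambda>z. (z - \<alpha>) ^ r * v z) \<in> O[at_infinity](\<lambda>z. z ^ (r - 1)) \<longleftrightarrow> ?thesis"
    proof (rule landau_o.big.in_cong)
      show "\<forall>\<^sub>F z in at_infinity. (z - \<alpha>) ^ r * v z = G2 z"
        using eventually_outside_outer
        by eventually_elim (simp add: G2_def G1_out outside_outer)
    qed
    finally show ?thesis .
  qed
  ultimately obtain Q where Q: "degree Q \<le> r - 1" "\<And>z. G2 z = poly Q z"
    using entire_bigo_power_imp_poly by blast
  show ?thesis
  proof (rule that[OF Q(1)])
    show "poly Q z = (z - \<alpha>) ^ r * v z - z ^ M / (1 + \<beta> * z) ^ m * A z" if "z \<in> inside \<Gamma>1" for z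
      using Q(2)[of z] that sides[of z] by (auto simp: G2_def G1_def G0_def)
    show "poly Q \<zeta> = (\<zeta> - \<alpha>) ^ r * v2m \<zeta>" if "\<zeta> \<in> \<Gamma>2" for \<zeta>
      using Q(2)[of \<zeta>] that by (simp add: G2_def)
  qed
qed

text \<open>
  On the outer contour \<open>v\<close> is \<open>Q / (z - \<alpha>) ^ r\<close>, so that \<open>z ^ M\<close> times the jump of \<open>u\<close> is
  \<open>- Q * (1 + \<beta> z) ^ m\<close>, a polynomial that can be added inside. The normalization of \<open>u\<close> at infinity
  makes the resulting polynomial monic.
\<close>
lemma polynomial_R:
  assumes A: "A holomorphic_on inside \<Gamma>2" "\<And>z. z \<notin> \<Gamma>1 \<Longrightarrow> A z = u z"
    and Q: "\<And>\<zeta>. \<zeta> \<in> \<Gamma>2 \<Longrightarrow> poly Q \<zeta> = (\<zeta> - \<alpha>) ^ r * v2m \<zeta>"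
  obtains R where "degree R = M" "lead_coeff R = 1"
    "\<And>z. z \<in> inside \<Gamma>2 \<Longrightarrow> poly R z = z ^ M * A z + poly Q z * (1 + \<beta> * z) ^ m"
proof -
  define R0 where "R0 z = (if z \<in> inside \<Gamma>2 then z ^ M * A z + poly Q z * (1 + \<beta> * z) ^ m else z ^ M * u z)" for z
  define R1 where "R1 z = (if z \<in> \<Gamma>2 then z ^ M * u2m z else R0 z)" for z
  have "R0 holomorphic_on inside \<Gamma>2 \<union> outside \<Gamma>2"
  proof (rule holomorphic_on_Un)
    have "(\<lambda>z. z ^ M * A z + poly Q z * (1 + \<beta> * z) ^ m) holomorphic_on inside \<Gamma>2"
      by (intro holomorphic_intros A)
    then show "R0 holomorphic_on inside \<Gamma>2" by (rule holomorphic_transform) (simp add: R0_def)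
    have "(\<lambda>z. z ^ M * u z) holomorphic_on outside \<Gamma>2"
      using sides by (intro holomorphic_intros holomorphic_on_subset[OF holo_u]) auto
    then show "R0 holomorphic_on outside \<Gamma>2" 
      by (rule holomorphic_transform) (use sides in \<open>auto simp: R0_def\<close>)
  qed (use open_sides in auto)
  then have R0: "R0 holomorphic_on UNIV - \<Gamma>2" by (simp add: inside_Un_outside Compl_eq_Diff_UNIV)
  have R1: "R1 holomorphic_on UNIV"
    unfolding R1_def
  proof (rule holomorphic_glue_across_contour[OF \<gamma>2(1,2) _ R0])
    show "continuous_on \<Gamma>2 (\<lambda>z. z ^ M * u2m z)" by (intro continuous_intros cont2)
    fix \<zeta> assume \<zeta>: "\<zeta> \<in> \<Gamma>2"
    have ne: "\<zeta> \<noteq> 0" using \<zeta> zero sides by blast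
    have "\<forall>\<^sub>F z in at \<zeta> within inside \<Gamma>2. u z = A z"
      using eventually_outside_of_inner[OF \<zeta>] by eventually_elim (metis A(2) sides(4))
    then have "(A \<longlongrightarrow> u2p \<zeta>) (at \<zeta> within inside \<Gamma>2)"
      using lim2(1)[OF \<zeta>] by (rule Lim_transform_eventually[rotated])
    then have "((\<lambda>z. z ^ M * A z + poly Q z * (1 + \<beta> * z) ^ m)
       \<longlongrightarrow> \<zeta> ^ M * u2p \<zeta> + poly Q \<zeta> * (1 + \<beta> * \<zeta>) ^ m) (at \<zeta> within inside \<Gamma>2)"
      by (intro tendsto_intros)
    also have "\<zeta> ^ M * u2p \<zeta> + poly Q \<zeta> * (1 + \<beta> * \<zeta>) ^ m = \<zeta> ^ M * u2m \<zeta>"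
      unfolding jump2(1)[OF \<zeta>] Q[OF \<zeta>] using ne by (simp add: field_simps)
    finally show "(R0 \<longlongrightarrow> \<zeta> ^ M * u2m \<zeta>) (at \<zeta> within inside \<Gamma>2)"
      by (rule Lim_transform_eventually) (auto simp: eventually_at_filter R0_def)
    have "((\<lambda>z. z ^ M * u z) \<longlongrightarrow> \<zeta> ^ M * u2m \<zeta>) (at \<zeta> within outside \<Gamma>2)"
      by (intro tendsto_intros lim2(2) \<zeta>)
    then show "(R0 \<longlongrightarrow> \<zeta> ^ M * u2m \<zeta>) (at \<zeta> within outside \<Gamma>2)"
      by (rule Lim_transform_eventually) (use sides in \<open>auto simp: eventually_at_filter R0_def\<close>)
  qed auto
  have "(\<lambda>z. R1 z - z ^ M) holomorphic_on UNIV" by (intro holomorphic_intros R1)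
  moreover have "(\<lambda>z. R1 z - z ^ M) \<in> O[at_infinity](\<lambda>z. z ^ (M - 1))"
  proof -
    have "(\<lambda>z. z ^ M * (u z - 1)) \<in> O[at_infinity](\<lambda>z. z ^ (M - 1))"
      by (intro bigo_power_mult_decay u_inf exponents) simp
    also have "(\<lambda>z. z ^ M * (u z - 1)) \<in> O[at_infinity](\<lambda>z. z ^ (M - 1)) \<longleftrightarrow> ?thesis"
    proof (rule landau_o.big.in_cong)
      show "\<forall>\<^sub>F z in at_infinity. z ^ M * (u z - 1) = R1 z - z ^ M"
        using eventually_outside_outer
        by eventually_elim (simp add: R1_def R0_def outside_outer algebra_simps)
    qed
    finally show ?thesis .
  qed
  ultimately obtain P where P: "degree P \<le> M - 1" "\<And>z. R1 z - z ^ M = poly P z"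
    using entire_bigo_power_imp_poly by blast
  have "degree P < degree (monom (1::complex) M)" using P(1) exponents(2) by (simp add: degree_monom_eq)
  then have "degree (monom 1 M + P) = M" "lead_coeff (monom 1 M + P) = 1"
    by (simp_all add: degree_add_eq_left degree_monom_eq coeff_eq_0)
  then show ?thesis
  proof (rule that)
    show "poly (monom 1 M + P) z = z ^ M * A z + poly Q z * (1 + \<beta> * z) ^ m" if "z \<in> inside \<Gamma>2" for z
      using that sides(6)[of z] by (simp add: poly_monom R1_def R0_def flip: P(2))
  qed
qed

text \<open>
  Inside the inner contour the definitions of \<open>Q\<close> and \<open>R\<close> combine to
  \<open>R = (z - \<alpha>) ^ r * (1 + \<beta> z) ^ m * v\<close>, with \<open>v\<close> analytic at \<open>\<alpha>\<close>: this is where divisibility by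
  \<open>(z - \<alpha>) ^ r\<close> comes from. Divisibility of \<open>R - Q * (1 + \<beta> z) ^ m\<close> by \<open>z ^ M\<close> holds because the
  continuation of \<open>u\<close> is analytic at \<open>0\<close>, even when \<open>0\<close> lies on the inner contour.
\<close>
lemma first_row_polynomials:
  obtains A S Q where "degree Q \<le> r - 1" "degree S = M - r" "lead_coeff S = 1" "r \<le> M"
    "monom 1 M * A = [:- \<alpha>, 1:] ^ r * S - Q * [:1, \<beta>:] ^ m"
    "\<forall>z\<in>inside \<Gamma>2 - \<Gamma>1. u z = poly A z"
proof -
  obtain A0 where A0: "A0 holomorphic_on inside \<Gamma>2" "\<And>z. z \<in> \<Gamma>1 \<Longrightarrow> A0 z = u1p z" "\<And>z. z \<notin> \<Gamma>1 \<Longrightarrow> A0 z = u z"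
    using extend_u by blast
  obtain Q where Q: "degree Q \<le> r - 1"
    "\<And>z. z \<in> inside \<Gamma>1 \<Longrightarrow> poly Q z = (z - \<alpha>) ^ r * v z - z ^ M / (1 + \<beta> * z) ^ m * A0 z"
    "\<And>\<zeta>. \<zeta> \<in> \<Gamma>2 \<Longrightarrow> poly Q \<zeta> = (\<zeta> - \<alpha>) ^ r * v2m \<zeta>"
    using polynomial_Q[OF A0(1,2)] by metis
  obtain R where R: "degree R = M" "lead_coeff R = 1"
    "\<And>z. z \<in> inside \<Gamma>2 \<Longrightarrow> poly R z = z ^ M * A0 z + poly Q z * (1 + \<beta> * z) ^ m"
    using polynomial_R[OF A0(1,3) Q(3)] by metis
  have "[:- \<alpha>, 1:] ^ r dvd R"
  proof (rule linear_power_dvd_if_factor[OF open_sides(1) \<alpha>])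
    show "(\<lambda>z. (1 + \<beta> * z) ^ m * v z) holomorphic_on inside \<Gamma>1"
      using sides by (intro holomorphic_intros holomorphic_on_subset[OF holo_v]) auto
    fix z assume z: "z \<in> inside \<Gamma>1"
    then have "1 + \<beta> * z \<noteq> 0" by (rule denominator_nonzero)
    then show "poly R z = (z - \<alpha>) ^ r * ((1 + \<beta> * z) ^ m * v z)"
      using z R(3)[of z] Q(2)[of z] sides(10) by (simp add: field_simps)
  qed
  then obtain S where S: "R = [:- \<alpha>, 1:] ^ r * S" by (elim dvdE)
  have "S \<noteq> 0" using R(2) S by auto
  then have "degree R = r + degree S" unfolding S
    by (simp add: degree_mult_eq degree_linear_power del: mult_pCons_left)
  moreover have "lead_coeff S = 1" using R(2) unfolding S by (simp add: lead_coeff_mult lead_coeff_power)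
  ultimately have dS: "degree S = M - r" "lead_coeff S = 1" "r \<le> M" using R(1) by auto
  have "[:- 0, 1:] ^ M dvd R - Q * [:1, \<beta>:] ^ m"
    by (rule linear_power_dvd_if_factor[OF open_sides(3) zero A0(1)]) (simp add: R(3) poly_power mult.commute)
  then obtain A where A: "R - Q * [:1, \<beta>:] ^ m = [:0, 1:] ^ M * A" by (auto elim: dvdE)
  have Au0: "poly A z = A0 z" if "z \<in> inside \<Gamma>2" "z \<noteq> 0" for z
  proof -
    have "z ^ M * poly A z = poly (R - Q * [:1, \<beta>:] ^ m) z" unfolding A by (simp add: poly_power)
    also have "\<dots> = z ^ M * A0 z" using R(3)[OF that(1)] by (simp add: poly_power mult.commute)
    finally show ?thesis using that(2) by simp
  qed
  \<comment> \<open>The division by \<open>z ^ M\<close> leaves out the origin, which is recovered by continuity.\<close>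
  have "poly A z = A0 z" if z: "z \<in> inside \<Gamma>2" for z
  proof (cases "z = 0")
    case True
    have "(A0 \<longlongrightarrow> A0 0) (at 0)"
      using A0(1) open_sides(3) zero by (meson continuous_on_eq_continuous_at holomorphic_on_imp_continuous_on isCont_def)
    moreover have "\<forall>\<^sub>F z in at 0. poly A z = A0 z"
      using eventually_at_in_open'[OF open_sides(3) zero] eventually_neq_at_within[of 0]
      by eventually_elim (rule Au0)
    then have "(A0 \<longlongrightarrow> poly A 0) (at 0)"
      by (rule Lim_transform_eventually[rotated]) (intro tendsto_intros)
    ultimately show ?thesis using True tendsto_unique[OF trivial_limit_at] by blast
  qed (use Au0 z in blast)
  then show ?thesis
    using A S A0(3) dS Q(1) by (intro that[of Q S A]) (auto simp: monom_altdef)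
qed
end

section \<open>The value at the origin\<close>

theorem proposition1p10:
  fixes a :: real and N m k :: nat
    and \<gamma>1 \<gamma>2 :: "real \<Rightarrow> complex" and U :: "complex \<Rightarrow> complex^2^2"
  assumes "0 < a" and "a \<le> 1" and "1 \<le> N" and "m \<in> {1..N}" and "k \<in> {1..m}"
    and "pos_closed_contour \<gamma>1"
    and "complex_of_real a \<in> inside (path_image \<gamma>1)"
    and "complex_of_real (- 1 / a) \<in> outside (path_image \<gamma>1)"
    and "pos_closed_contour \<gamma>2"
    and "path_image \<gamma>1 \<subseteq> inside (path_image \<gamma>2)"
    and "0 \<in> inside (path_image \<gamma>2)"
    and "RHP_solution N m k a \<gamma>1 \<gamma>2 U"
  shows "(0 \<notin> path_image \<gamma>1 \<longrightarrow> U 0 $ 1 $ 1 = pade_kappa N m k a) \<and>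
         ((\<lambda>z. U z $ 1 $ 1) \<longlongrightarrow> pade_kappa N m k a) (at 0 within - path_image \<gamma>1)"
proof -
  note rhp = assms(12)[unfolded RHP_solution_def]
  have jumps: "has_jump U \<gamma>1 (jump_1 N m k a)" "has_jump U \<gamma>2 (jump_2 N m k a)"
    using rhp by blast+
  have analytic: "(\<lambda>z. U z $ i $ j) analytic_on - (path_image \<gamma>1 \<union> path_image \<gamma>2)" for i j :: 2
    using rhp by blast
  have infinity: "(\<lambda>z. U z $ i $ j - (mat 1 :: complex^2^2) $ i $ j) \<in> O[at_infinity](\<lambda>z. 1 / z)" for i j
    using rhp by blast
  obtain u1p u1m v1p v1m where
    one: "continuous_on (path_image \<gamma>1) u1p" "continuous_on (path_image \<gamma>1) u1m"
    "continuous_on (path_image \<gamma>1) v1p" "continuous_on (path_image \<gamma>1) v1m"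
    "\<forall>\<zeta>\<in>path_image \<gamma>1. ((\<lambda>z. U z $ 1 $ 1) \<longlongrightarrow> u1p \<zeta>) (at \<zeta> within inside (path_image \<gamma>1))"
    "\<forall>\<zeta>\<in>path_image \<gamma>1. ((\<lambda>z. U z $ 1 $ 1) \<longlongrightarrow> u1m \<zeta>) (at \<zeta> within outside (path_image \<gamma>1))"
    "\<forall>\<zeta>\<in>path_image \<gamma>1. ((\<lambda>z. U z $ 1 $ 2) \<longlongrightarrow> v1p \<zeta>) (at \<zeta> within inside (path_image \<gamma>1))"
    "\<forall>\<zeta>\<in>path_image \<gamma>1. ((\<lambda>z. U z $ 1 $ 2) \<longlongrightarrow> v1m \<zeta>) (at \<zeta> within outside (path_image \<gamma>1))"
    "\<forall>\<zeta>\<in>path_image \<gamma>1. u1p \<zeta> = u1m \<zeta> * jump_1 N m k a \<zeta> $ 1 $ 1 + v1m \<zeta> * jump_1 N m k a \<zeta> $ 2 $ 1"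
    "\<forall>\<zeta>\<in>path_image \<gamma>1. v1p \<zeta> = u1m \<zeta> * jump_1 N m k a \<zeta> $ 1 $ 2 + v1m \<zeta> * jump_1 N m k a \<zeta> $ 2 $ 2"
    by (rule has_jump_first_row[OF jumps(1)])
  obtain u2p u2m v2p v2m where
    two: "continuous_on (path_image \<gamma>2) u2p" "continuous_on (path_image \<gamma>2) u2m"
    "continuous_on (path_image \<gamma>2) v2p" "continuous_on (path_image \<gamma>2) v2m"
    "\<forall>\<zeta>\<in>path_image \<gamma>2. ((\<lambda>z. U z $ 1 $ 1) \<longlongrightarrow> u2p \<zeta>) (at \<zeta> within inside (path_image \<gamma>2))"
    "\<forall>\<zeta>\<in>path_image \<gamma>2. ((\<lambda>z. U z $ 1 $ 1) \<longlongrightarrow> u2m \<zeta>) (at \<zeta> within outside (path_image \<gamma>2))"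
    "\<forall>\<zeta>\<in>path_image \<gamma>2. ((\<lambda>z. U z $ 1 $ 2) \<longlongrightarrow> v2p \<zeta>) (at \<zeta> within inside (path_image \<gamma>2))"
    "\<forall>\<zeta>\<in>path_image \<gamma>2. ((\<lambda>z. U z $ 1 $ 2) \<longlongrightarrow> v2m \<zeta>) (at \<zeta> within outside (path_image \<gamma>2))"
    "\<forall>\<zeta>\<in>path_image \<gamma>2. u2p \<zeta> = u2m \<zeta> * jump_2 N m k a \<zeta> $ 1 $ 1 + v2m \<zeta> * jump_2 N m k a \<zeta> $ 2 $ 1"
    "\<forall>\<zeta>\<in>path_image \<gamma>2. v2p \<zeta> = u2m \<zeta> * jump_2 N m k a \<zeta> $ 1 $ 2 + v2m \<zeta> * jump_2 N m k a \<zeta> $ 2 $ 2"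
    by (rule has_jump_first_row[OF jumps(2)])
  have mk: "1 \<le> k" "k \<le> m" "m \<le> N" using assms(4,5) by auto
  interpret first_row_rhp \<gamma>1 \<gamma>2 "of_real a" "of_real a" "N - m + 1" m "N - m + k"
    "\<lambda>z. U z $ 1 $ 1" "\<lambda>z. U z $ 1 $ 2" u1p u1m v1p v1m u2p u2m v2p v2m
  proof
    show "valid_path \<gamma>1" "simple_path \<gamma>1" "pathfinish \<gamma>1 = pathstart \<gamma>1"
      "valid_path \<gamma>2" "simple_path \<gamma>2" "pathfinish \<gamma>2 = pathstart \<gamma>2"
      using assms(6,9) by (auto simp: pos_closed_contour_def)
    show "z \<in> outside (path_image \<gamma>1)" if "1 + complex_of_real a * z = 0" for z
    proof -
      have "z * complex_of_real a = - 1" using that by (simp add: eq_neg_iff_add_eq_0 ac_simps)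
      then have "z = - 1 / complex_of_real a" using assms(1) by (subst nonzero_eq_divide_eq) simp_all
      then show ?thesis using assms(8) by simp
    qed
    show "1 \<le> N - m + 1" "1 \<le> N - m + k" using mk by simp_all
    show "(\<lambda>z. U z $ 1 $ 1) holomorphic_on - (path_image \<gamma>1 \<union> path_image \<gamma>2)"
      "(\<lambda>z. U z $ 1 $ 2) holomorphic_on - (path_image \<gamma>1 \<union> path_image \<gamma>2)"
      by (rule analytic_imp_holomorphic[OF analytic])+
    show "(\<lambda>z. U z $ 1 $ 1 - 1) \<in> O[at_infinity](\<lambda>z. 1 / z)" "(\<lambda>z. U z $ 1 $ 2) \<in> O[at_infinity](\<lambda>z. 1 / z)"
      using infinity[of 1 1] infinity[of 1 2] by (simp_all add: mat_def)
  qed (use assms one two in \<open>simp_all add: jump_1_def jump_2_def\<close>)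
  obtain A S Q where ASQ: "degree Q \<le> N - m + 1 - 1" "degree S = N - m + k - (N - m + 1)" "lead_coeff S = 1"
    "monom 1 (N - m + k) * A = [:- of_real a, 1:] ^ (N - m + 1) * S - Q * [:1, of_real a:] ^ m"
    "\<forall>z\<in>inside (path_image \<gamma>2) - path_image \<gamma>1. U z $ 1 $ 1 = poly A z"
    by (rule first_row_polynomials)
  have degs: "degree Q \<le> N - m" "degree S = k - 1" using ASQ(1,2) mk by simp_all
  have "degree (monom 1 (N - m + k) * A) \<le> N"
    unfolding ASQ(4)
  proof (rule degree_diff_le)
    have "degree ([:- complex_of_real a, 1:] ^ (N - m + 1)) = N - m + 1" by (rule degree_linear_power)
    then show "degree ([:- complex_of_real a, 1:] ^ (N - m + 1) * S) \<le> N"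
      using degree_mult_le[of "[:- complex_of_real a, 1:] ^ (N - m + 1)" S] degs mk by linarith
    have "degree ([:1, complex_of_real a:] ^ m) \<le> m"
      using degree_power_le[of "[:1, complex_of_real a:]" m] by (simp split: if_splits)
    then show "degree (Q * [:1, complex_of_real a:] ^ m) \<le> N"
      using degree_mult_le[of Q "[:1, complex_of_real a:] ^ m"] degs mk by linarith
  qed
  then have "degree A \<le> m - k"
    using mk by (cases "A = 0") (auto simp: degree_mult_eq degree_monom_eq)
  then have \<kappa>: "pade_kappa N m k a = coeff A 0"
    using assms(1) mk degs ASQ(3,4) by (intro pade_kappa_eq[where S = S and Q = Q]) simp_all
  show ?thesis
  proof
    show "0 \<notin> path_image \<gamma>1 \<longrightarrow> U 0 $ 1 $ 1 = pade_kappa N m k a"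
      using ASQ(5) assms(11) by (simp add: \<kappa> poly_0_coeff_0)
    have "(poly A \<longlongrightarrow> poly A 0) (at 0 within - path_image \<gamma>1)" by (intro tendsto_intros)
    moreover have "\<forall>\<^sub>F z in at 0 within - path_image \<gamma>1. poly A z = U z $ 1 $ 1"
      using eventually_nhds_in_open[OF open_sides(3) assms(11)]
      by (auto simp: eventually_at_filter ASQ(5) elim: eventually_mono)
    ultimately show "((\<lambda>z. U z $ 1 $ 1) \<longlongrightarrow> pade_kappa N m k a) (at 0 within - path_image \<gamma>1)"
      by (simp add: \<kappa> poly_0_coeff_0 Lim_transform_eventually)
  qed
qed

end
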